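(* Let $\mu$ be an atomless Borel probability measure on $X$ that is invariant and ergodic under the action of $\mathbb Z^2$. Then one and only one of the following two properties holds. (i) $\mu(Z)=0$, and there exists a $\mathbb Z^2$-invariant Borel set $B\subset X$ with $\mu(B)=1$ such that, for every $x\in Y\cap B$, the $\sigma$-component of $x$ contains all the points of the $\mathbb Z^2$-orbit of $x$ that belong to $Y$. (ii) $\mu(Z)>0$, and there exists a $\mathbb Z^2$-invariant Borel set $B\subset X$ with $\mu(B)=1$ having the following properties: (a) for every $x\in Y\cap B$, the $\sigma$-component of $x$ contains points of $Z$; (b) for every $x\in Z\cap B$, the set $\sigma^{-1}(x)$ contains one and only one point of $Z$; (c) for every $x\in Y\cap B$, the $\mathbb Z^2$-orbit of $x$ contains infinitely many $\sigma$-components. More precisely, for every $\sigma$-component $C$ of the $\mathbb Z^2$-orbit of $x$, there exists a unique $k\in\mathbb Z$ such that $T^kS^{-k}x\in Z\cap C$, and the set $\{k\in\mathbb Z \mid T^kS^{-k}x\in Z\}$ is bounded neither above nor below.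
   Context: $X$ is the set of families $x=(x_{k,l})_{(k,l)\in\mathbb Z^2}$ in $(\mathbb Z/2\mathbb Z)^{\mathbb Z^2}$ such that $x_{k,l}+x_{k+1,l}+x_{k,l+1}=0$ in $\mathbb Z/2\mathbb Z$ for all $(k,l)\in\mathbb Z^2$, with its compact topology (induced by the product topology). $\mathbb Z^2$ acts on $X$ by homeomorphisms through the commuting maps $T:(x_{k,l})\mapsto(x_{k+1,l})$ and $S:(x_{k,l})\mapsto(x_{k,l+1})$. $Y=\{x\in X\mid x_{0,0}=1\}$. If $x\in Y$ then $x_{1,0}+x_{0,1}=1$, so exactly one of $Tx$, $Sx$ belongs to $Y$; this element is denoted $\sigma(x)$, which defines a continuous map $\sigma:Y\to Y$. For $x\in Y$, the $\sigma$-component of $x$ is the set of points $y\in Y$ of the $\mathbb Z^2$-orbit of $x$ for which there exist integers $p,q\ge 0$ with $\sigma^p(x)=\sigma^q(y)$. The $\sigma$-components of a $\mathbb Z^2$-orbit are the $\sigma$-components of the points of that orbit lying in $Y$. The $\sigma$-antecedents of $x\in Y$ are the elements of $\bigcup_{n\ge 1}\sigma^{-n}(x)$. $Z$ is the set of elements of $Y$ that have infinitely many $\sigma$-antecedents. *)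

theory Defs
  imports "HOL-Probability.Probability" "HOL-Library.Z2"
begin

text \<open>
  \<open>\<int>/2\<int>\<close> is \<^typ>\<open>bit\<close>, with the discrete topology; the function type
  \<open>int \<times> int \<Rightarrow> bit\<close> then carries the product topology.
\<close>

instantiation bit :: topological_space
begin

definition open_bit :: "bit set \<Rightarrow> bool"
  where "open_bit U \<longleftrightarrow> True"

instance
  by standard (auto simp: open_bit_def)

end

instance bit :: discrete_topology
  by standard (auto simp: open_bit_def)

instance bit :: second_countable_topology
proof
  have "finite (UNIV :: bit set)"
    by (rule finite_subset[of _ "{0, 1}"]) auto
  then have "countable (UNIV :: bit set set)"
    by (intro countable_finite) (simp flip: Pow_UNIV)
  moreover have "open = generate_topology (UNIV :: bit set set)"
    by (simp add: fun_eq_iff open_bit_def generate_topology.Basis)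
  ultimately show "\<exists>B :: bit set set. countable B \<and> open = generate_topology B"
    by blast
qed

type_synonym config = "int \<times> int \<Rightarrow> bit"

definition XL :: "config set" where
  "XL = {x. \<forall>k l. x (k, l) + x (k + 1, l) + x (k, l + 1) = 0}"

text \<open>
  \<open>shiftZ2 m n\<close> is the action of \<open>(m, n) \<in> \<int>\<^sup>2\<close>, that is \<open>T\<^sup>m S\<^sup>n\<close>; see the lemmas
  \<open>shift_add\<close> and \<open>shift_Suc\<close>.
\<close>

definition shiftZ2 :: "int \<Rightarrow> int \<Rightarrow> config \<Rightarrow> config" where
  "shiftZ2 m n x = (\<lambda>(k, l). x (k + m, l + n))"

abbreviation shiftT :: "config \<Rightarrow> config" where "shiftT \<equiv> shiftZ2 1 0"

abbreviation shiftS :: "config \<Rightarrow> config" where "shiftS \<equiv> shiftZ2 0 1"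

lemma shift_zero: "shiftZ2 0 0 x = x"
  by (auto simp: shiftZ2_def)

lemma shift_add: "shiftZ2 m n (shiftZ2 m' n' x) = shiftZ2 (m + m') (n + n') x"
  by (auto simp: shiftZ2_def fun_eq_iff add_ac)

lemma shift_Suc:
  "shiftZ2 (m + 1) n x = shiftT (shiftZ2 m n x)"
  "shiftZ2 m (n + 1) x = shiftS (shiftZ2 m n x)"
  by (simp_all add: shift_add add_ac)

lemma shift_in_XL: "x \<in> XL \<Longrightarrow> shiftZ2 m n x \<in> XL"
proof -
  assume "x \<in> XL"
  then have "x (k + m, l + n) + x (k + m + 1, l + n) + x (k + m, l + n + 1) = 0" for k l
    unfolding XL_def by blast
  then show ?thesis
    by (simp add: XL_def shiftZ2_def algebra_simps)
qed

definition orbit :: "config \<Rightarrow> config set" where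
  "orbit x = {y. \<exists>m n. y = shiftZ2 m n x}"

definition Z2_invariant :: "config set \<Rightarrow> bool" where
  "Z2_invariant B \<longleftrightarrow> (\<forall>m n. shiftZ2 m n ` B = B)"

definition YL :: "config set" where
  "YL = {x \<in> XL. x (0, 0) = 1}"

text \<open>Only the values of \<open>\<sigma>\<close> on \<open>Y\<close> are meaningful.\<close>

definition sigmaL :: "config \<Rightarrow> config" where
  "sigmaL x = (if shiftT x \<in> YL then shiftT x else shiftS x)"

lemma exactly_one_in_YL:
  assumes "x \<in> YL"
  shows "shiftT x \<in> YL \<longleftrightarrow> shiftS x \<notin> YL"
proof -
  have "x (0, 0) + x (1, 0) + x (0, 1) = 0"
    using assms unfolding YL_def XL_def mem_Collect_eq by (metis add_0)
  moreover have "shiftT x \<in> YL \<longleftrightarrow> x (1, 0) = 1" "shiftS x \<in> YL \<longleftrightarrow> x (0, 1) = 1"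
    using assms shift_in_XL[of x] by (simp_all add: YL_def) (simp_all add: shiftZ2_def)
  ultimately show ?thesis
    using assms by (cases "x (1, 0)"; cases "x (0, 1)") (auto simp: YL_def)
qed

lemma sigma_unique:
  assumes "x \<in> YL"
  shows "sigmaL x \<in> YL" "y \<in> {shiftT x, shiftS x} \<Longrightarrow> y \<in> YL \<Longrightarrow> y = sigmaL x"
  using exactly_one_in_YL[OF assms] by (auto simp: sigmaL_def)

definition sigma_component :: "config \<Rightarrow> config set" where
  "sigma_component x = {y \<in> orbit x \<inter> YL. \<exists>p q. (sigmaL ^^ p) x = (sigmaL ^^ q) y}"

definition orbit_components :: "config \<Rightarrow> config set set" where
  "orbit_components x = sigma_component ` (orbit x \<inter> YL)"

definition antecedents :: "config \<Rightarrow> config set" where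
  "antecedents x = (\<Union>n\<in>{1..}. {y \<in> YL. (sigmaL ^^ n) y = x})"

definition ZL :: "config set" where
  "ZL = {x \<in> YL. infinite (antecedents x)}"

definition borel_XL :: "config measure" where
  "borel_XL = restrict_space borel XL"

definition atomless_measure :: "'a measure \<Rightarrow> bool" where
  "atomless_measure M \<longleftrightarrow>
    (\<forall>A\<in>sets M. emeasure M A > 0 \<longrightarrow>
      (\<exists>B\<in>sets M. B \<subseteq> A \<and> 0 < emeasure M B \<and> emeasure M B < emeasure M A))"

definition invariant_measure :: "config measure \<Rightarrow> bool" where
  "invariant_measure \<mu> \<longleftrightarrow> (\<forall>m n. distr \<mu> \<mu> (shiftZ2 m n) = \<mu>)"

text \<open>For a countable group, testing strictly invariant sets suffices.\<close>

definition ergodic_measure :: "config measure \<Rightarrow> bool" where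
  "ergodic_measure \<mu> \<longleftrightarrow>
    (\<forall>A\<in>sets \<mu>. Z2_invariant A \<longrightarrow> measure \<mu> A = 0 \<or> measure \<mu> A = 1)"

text \<open>
  The following lemmas show that \<open>distr\<close> above and \<open>measure \<mu> ZL\<close> below are applied to
  measurable arguments only.
\<close>

lemma closed_XL: "closed XL"
proof -
  have eval: "continuous_on UNIV (\<lambda>x::config. x i)" for i
    by (rule continuous_on_product_coordinates)
  have "closed {x::config. x i + x j + x k = 0}" for i j k
  proof -
    have "{x::config. x i + x j + x k = 0} =
        (\<Union>(a, b, c)\<in>{(a, b, c). a + b + c = 0}. {x. x i = a} \<inter> {x. x j = b} \<inter> {x. x k = c})"
      by auto
    moreover have "finite {(a::bit, b::bit, c::bit). a + b + c = 0}"
    proof -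
      have "finite (UNIV :: bit set)"
        by (rule finite_subset[of _ "{0, 1}"]) auto
      then have "finite (UNIV \<times> UNIV \<times> UNIV :: (bit \<times> bit \<times> bit) set)"
        by blast
      then show ?thesis
        by (rule rev_finite_subset) auto
    qed
    ultimately show ?thesis
      by (auto intro!: closed_UN closed_Int closed_Collect_eq eval continuous_on_const)
  qed
  then show ?thesis
    unfolding XL_def by (intro closed_Collect_all)
qed

lemma sets_borel_XL: "A \<in> sets borel_XL \<longleftrightarrow> A \<in> sets borel \<and> A \<subseteq> XL"
  unfolding borel_XL_def by (subst sets_restrict_space_iff) (use closed_XL in auto)

lemma continuous_on_shift: "continuous_on UNIV (shiftZ2 m n)"
  unfolding shiftZ2_def
  by (intro continuous_on_coordinatewise_then_product)
    (auto simp: case_prod_beta intro: continuous_on_product_coordinates)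

lemma measurable_shift: "shiftZ2 m n \<in> borel_measurable borel"
  by (intro borel_measurable_continuous_onI continuous_on_shift)

lemma measurable_shift_XL: "shiftZ2 m n \<in> measurable borel_XL borel_XL"
  unfolding borel_XL_def
  by (intro measurable_restrict_space3 measurable_shift) (auto simp: shift_in_XL)

lemma YL_borel: "YL \<in> sets borel"
proof -
  have "closed {x::config. x (0, 0) = 1}"
    by (intro closed_Collect_eq continuous_on_product_coordinates continuous_on_const)
  moreover have "YL = XL \<inter> {x. x (0, 0) = 1}"
    by (auto simp: YL_def)
  ultimately show ?thesis
    using closed_XL by (metis borel_closed closed_Int)
qed

lemma measurable_sigma_pow: "(sigmaL ^^ n) \<in> borel_measurable borel"
proof (induction n)
  case (Suc n)
  have "sigmaL \<in> borel_measurable borel"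
    unfolding sigmaL_def
    by (intro measurable_If measurable_shift pred_sets1[OF _ measurable_shift])
       (use YL_borel measurable_sets[OF measurable_shift YL_borel] in \<open>auto simp: vimage_def\<close>)
  with Suc show ?case
    by (simp add: measurable_comp)
qed (simp add: id_def)

lemma sigma_pow_in_orbit: "\<exists>i j. (sigmaL ^^ n) y = shiftZ2 i j y"
proof (induction n)
  case 0
  show ?case
    using shift_zero[of y] by (metis funpow_0)
next
  case (Suc n)
  then obtain i j where "(sigmaL ^^ n) y = shiftZ2 i j y"
    by blast
  then have "(sigmaL ^^ Suc n) y = shiftZ2 (1 + i) j y \<or> (sigmaL ^^ Suc n) y = shiftZ2 i (1 + j) y"
    by (simp add: sigmaL_def shift_add)
  then show ?case
    by blast
qed

lemma ZL_borel: "ZL \<in> sets borel_XL"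
proof -
  define P where "P = (\<lambda>(i, j, n) x. shiftZ2 i j x \<in> YL \<and> 1 \<le> n \<and> (sigmaL ^^ n) (shiftZ2 i j x) = x)"
  define f where "f = (\<lambda>(i :: int, j :: int, n :: nat). shiftZ2 i j)"
  have ante: "antecedents x = {f a x | a. P a x}" for x
  proof (intro set_eqI iffI)
    fix y assume "y \<in> antecedents x"
    then obtain n where n: "1 \<le> n" "y \<in> YL" "(sigmaL ^^ n) y = x"
      by (auto simp: antecedents_def)
    obtain i j where "(sigmaL ^^ n) y = shiftZ2 i j y"
      using sigma_pow_in_orbit by blast
    then have "x = shiftZ2 i j y"
      using n by simp
    then have "y = shiftZ2 (- i) (- j) x"
      by (simp add: shift_add shift_zero)
    then show "y \<in> {f a x | a. P a x}"
      using n by (auto simp: P_def f_def)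
  qed (auto simp: antecedents_def P_def f_def)
  have fin: "finite (antecedents x) \<longleftrightarrow>
      (\<exists>F\<in>Collect finite. \<forall>a. P a x \<longrightarrow> (\<exists>b\<in>F. f a x = f b x))" for x
  proof
    assume "finite (antecedents x)"
    moreover have "antecedents x = (\<lambda>a. f a x) ` {a. P a x}"
      by (auto simp: ante)
    ultimately obtain F where "finite F" "antecedents x = (\<lambda>a. f a x) ` F"
      by (metis finite_subset_image subset_refl)
    then show "\<exists>F\<in>Collect finite. \<forall>a. P a x \<longrightarrow> (\<exists>b\<in>F. f a x = f b x)"
      using ante[of x] by (intro bexI[of _ F]) blast+
  next
    assume "\<exists>F\<in>Collect finite. \<forall>a. P a x \<longrightarrow> (\<exists>b\<in>F. f a x = f b x)"
    then obtain F where "finite F" "\<forall>a. P a x \<longrightarrow> (\<exists>b\<in>F. f a x = f b x)"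
      by blast
    then have "antecedents x \<subseteq> (\<lambda>a. f a x) ` F"
      unfolding ante by blast
    then show "finite (antecedents x)"
      using \<open>finite F\<close> finite_imageI finite_subset by metis
  qed
  have eq: "{x. g x = h x} \<in> sets borel"
    if "g \<in> borel_measurable borel" "h \<in> borel_measurable borel" for g h :: "config \<Rightarrow> config"
  proof -
    have coord: "{x. g x i = c} \<in> sets borel" "{x. h x i = c} \<in> sets borel" for i c
    proof -
      have "closed {y::config. y i = c}"
        by (intro closed_Collect_eq continuous_on_product_coordinates continuous_on_const)
      then have "{y::config. y i = c} \<in> sets borel"
        by auto
      then show "{x. g x i = c} \<in> sets borel" "{x. h x i = c} \<in> sets borel"
        using measurable_sets[OF that(1)] measurable_sets[OF that(2)]
        by (fastforce simp: vimage_def)+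
    qed
    have "{x. g x = h x} =
        (\<Inter>i. ({x. g x i = 0} \<inter> {x. h x i = 0}) \<union> ({x. g x i = 1} \<inter> {x. h x i = 1}))"
      by (auto simp: fun_eq_iff) (metis bit_not_one_iff)+
    also have "\<dots> \<in> sets borel"
      by (intro sets.countable_INT'' sets.Un sets.Int coord) auto
    finally show ?thesis .
  qed
  have P_borel: "{x. P a x} \<in> sets borel" for a
  proof -
    obtain i j n where a: "a = (i, j, n)"
      by (cases a)
    have "{x. shiftZ2 i j x \<in> YL} \<in> sets borel"
      using measurable_sets[OF measurable_shift YL_borel] by (simp add: vimage_def)
    moreover have "{x. (sigmaL ^^ n) (shiftZ2 i j x) = x} \<in> sets borel"
      by (intro eq measurable_compose[OF measurable_shift measurable_sigma_pow]) simp
    moreover have "{x. P a x} =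
        (if 1 \<le> n then {x. shiftZ2 i j x \<in> YL} \<inter> {x. (sigmaL ^^ n) (shiftZ2 i j x) = x} else {})"
      by (auto simp: P_def a)
    ultimately show ?thesis
      by auto
  qed
  have f_borel: "{x. f a x = f b x} \<in> sets borel" for a b
    by (cases a; cases b) (auto simp: f_def intro!: eq measurable_shift)
  have "{x. finite (antecedents x)} =
      (\<Union>F\<in>Collect finite. \<Inter>a. (- {x. P a x}) \<union> (\<Union>b\<in>F. {x. f a x = f b x}))"
    unfolding fin by auto
  also have "\<dots> \<in> sets borel"
  proof (rule sets.countable_UN'')
    show "countable (Collect finite :: (int \<times> int \<times> nat) set set)"
      by (rule countable_Collect_finite)
    show "(\<Inter>a. (- {x. P a x}) \<union> (\<Union>b\<in>F. {x. f a x = f b x})) \<in> sets borel"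
      if "F \<in> Collect finite" for F
      using that
      by (intro sets.countable_INT'' sets.Un sets.finite_UN f_borel borel_comp P_borel) auto
  qed
  finally have "YL - {x. finite (antecedents x)} \<in> sets borel"
    by (intro sets.Diff YL_borel)
  moreover have "ZL = YL - {x. finite (antecedents x)}"
    by (auto simp: ZL_def)
  ultimately show ?thesis
    unfolding sets_borel_XL by (auto simp: YL_def)
qed

definition property_i :: "config measure \<Rightarrow> bool" where
  "property_i \<mu> \<longleftrightarrow>
    measure \<mu> ZL = 0 \<and>
    (\<exists>B\<in>sets \<mu>. Z2_invariant B \<and> measure \<mu> B = 1 \<and>
      (\<forall>x \<in> YL \<inter> B. orbit x \<inter> YL \<subseteq> sigma_component x))"

definition property_ii :: "config measure \<Rightarrow> bool" where
  "property_ii \<mu> \<longleftrightarrow>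
    measure \<mu> ZL > 0 \<and>
    (\<exists>B\<in>sets \<mu>. Z2_invariant B \<and> measure \<mu> B = 1 \<and>
      (\<forall>x \<in> YL \<inter> B. sigma_component x \<inter> ZL \<noteq> {}) \<and>
      (\<forall>x \<in> ZL \<inter> B. \<exists>!y. y \<in> {y \<in> YL. sigmaL y = x} \<inter> ZL) \<and>
      (\<forall>x \<in> YL \<inter> B.
        infinite (orbit_components x) \<and>
        (\<forall>C \<in> orbit_components x. \<exists>!k. shiftZ2 k (- k) x \<in> ZL \<inter> C) \<and>
        \<not> bdd_above {k. shiftZ2 k (- k) x \<in> ZL} \<and>
        \<not> bdd_below {k. shiftZ2 k (- k) x \<in> ZL}))"

end

theory Submission
  imports Defs
begin

text \<open>
  Points of the orbit of \<open>x\<close> are indexed by sites: \<open>site x n k\<close> lies on the antidiagonal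
  \<open>n\<close> at abscissa \<open>k\<close>. The rule defining \<open>XL\<close> says that \<open>\<sigma>\<close> moves every one of an
  antidiagonal to a one of the next antidiagonal, at the same abscissa or the next one. Such a step is
  weakly increasing in \<open>k\<close>, so the \<open>\<sigma>\<close>-paths coalesce without crossing and the
  components cut the ones of every antidiagonal into intervals. Apart from this planarity the proof
  uses a conservation of mass: an injective map from a set of positive measure to itself which acts
  piecewise by elements of \<open>\<int>\<^sup>2\<close> is almost surely onto (\<open>AE_injective_onto\<close>).

  The mass principle is applied twice. Call a one rightmost if it is the last one of its component on
  its antidiagonal. If \<open>e\<close> is rightmost, then the component of \<open>e\<close> has a rightmost one
  on the next antidiagonal, and different rightmost ones have different images because they belong to
  different components. Hence this map is onto: almost surely a component which has a rightmost one on
  an antidiagonal also had one on the previous antidiagonal, so it reaches back to \<open>-\<infinity>\<close>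
  (\<open>AE_rightmost_antecedent\<close>). Secondly, call a one ancient if it has \<open>\<sigma>\<close>-ancestors of
  every generation; for a free orbit these are the points of \<open>Z\<close>. By Koenig's lemma an ancient one
  has an ancient antecedent. Choosing one of them is injective, hence onto, so that the ancient
  antecedent is unique (\<open>AE_ancient_step_inj\<close>), and a component contains at most one ancient one on
  each antidiagonal.

  By ergodicity there are two cases. If there are almost surely no rightmost ones, then any two ones
  of an antidiagonal coalesce, so that there is a single component; it has at most one ancient one on
  an antidiagonal, but recurrence along the antidiagonal would give infinitely many, so \<open>Z\<close> is
  null. This is case (i). Otherwise almost every orbit has rightmost ones, by
  recurrence they are unbounded in both directions on every antidiagonal, and each component,
  enclosed between two rightmost ones, is finite on every antidiagonal. It also reaches back to
  \<open>-\<infinity>\<close>, so Koenig's lemma yields an ancient one in it, which is case (ii).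

  A measure without atoms gives no mass to points with a nontrivial period, because for each period
  there are only finitely many of them (\<open>finite_periodic\<close>); so almost surely different sites of an
  orbit are different points.
\<close>

section \<open>Sites\<close>

definition one :: "config \<Rightarrow> int \<Rightarrow> int \<Rightarrow> bool" where
  "one x n k \<longleftrightarrow> x (k, n - k) = 1"

definition site :: "config \<Rightarrow> int \<Rightarrow> int \<Rightarrow> config" where
  "site x n k = shiftZ2 k (n - k) x"

text \<open>
  For a one at \<open>k\<close>, exactly one of \<open>k\<close>, \<open>k + 1\<close> carries a one on the next antidiagonal,
  and this is the displacement made by \<open>\<sigma>\<close>; the definition makes sense for zeros as well, which
  keeps monotonicity free of side conditions.
\<close>

definition step :: "config \<Rightarrow> int \<Rightarrow> int \<Rightarrow> int" where
  "step x n k = (if one x (n + 1) (k + 1) then k + 1 else k)"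

primrec walk :: "config \<Rightarrow> int \<Rightarrow> int \<Rightarrow> nat \<Rightarrow> int" where
  "walk x n k 0 = k"
| "walk x n k (Suc p) = step x (n + int p) (walk x n k p)"

definition coalesce :: "config \<Rightarrow> int \<Rightarrow> int \<Rightarrow> int \<Rightarrow> bool" where
  "coalesce x n j k \<longleftrightarrow> (\<exists>p. walk x n j p = walk x n k p)"

definition rightmost :: "config \<Rightarrow> int \<Rightarrow> int \<Rightarrow> bool" where
  "rightmost x n k \<longleftrightarrow> one x n k \<and> (\<forall>j>k. one x n j \<longrightarrow> \<not> coalesce x n k j)"

text \<open>
  This is the site version of having infinitely many antecedents; in contrast to \<open>ZL\<close> it counts
  generations instead of points, which may repeat on a periodic orbit.
\<close>

definition ancient :: "config \<Rightarrow> int \<Rightarrow> int \<Rightarrow> bool" where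
  "ancient x n k \<longleftrightarrow> (\<forall>p. \<exists>j. one x (n - int p) j \<and> walk x (n - int p) j p = k)"

lemma shift_eq_site: "shiftZ2 a b x = site x (a + b) a"
  by (simp add: site_def)

lemma site_site [simp]: "site (site x n k) m j = site x (n + m) (k + j)"
  by (simp add: site_def shift_add algebra_simps)

lemma site_0 [simp]: "site x 0 0 = x"
  by (simp add: site_def shift_zero)

lemma site_in_XL: "x \<in> XL \<Longrightarrow> site x n k \<in> XL"
  by (simp add: site_def shift_in_XL)

lemma one_site [simp]: "one (site x n k) m j \<longleftrightarrow> one x (n + m) (k + j)"
  by (simp add: one_def site_def shiftZ2_def algebra_simps)

lemma step_site [simp]: "step (site x n k) m j = step x (n + m) (k + j) - k"
  by (simp add: step_def algebra_simps)

lemma walk_site [simp]: "walk (site x n k) m j p = walk x (n + m) (k + j) p - k"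
  by (induction p) (simp_all add: algebra_simps)

lemma coalesce_site [simp]: "coalesce (site x n k) m i j \<longleftrightarrow> coalesce x (n + m) (k + i) (k + j)"
  by (simp add: coalesce_def)

lemma rightmost_site [simp]: "rightmost (site x n k) m j \<longleftrightarrow> rightmost x (n + m) (k + j)"
proof -
  have "(\<forall>i>j. one x (n + m) (k + i) \<longrightarrow> \<not> coalesce x (n + m) (k + j) (k + i)) \<longleftrightarrow>
      (\<forall>i>k + j. one x (n + m) i \<longrightarrow> \<not> coalesce x (n + m) (k + j) i)" (is "?L \<longleftrightarrow> ?R")
  proof
    assume L: ?L
    show ?R
    proof (intro allI impI)
      fix i assume "k + j < i" "one x (n + m) i"
      then show "\<not> coalesce x (n + m) (k + j) i"
        using L[rule_format, of "i - k"] by simp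
    qed
  qed simp
  then show ?thesis
    by (simp add: rightmost_def)
qed

lemma ancient_site [simp]: "ancient (site x n k) m j \<longleftrightarrow> ancient x (n + m) (k + j)"
proof -
  have "(\<exists>i. one x (n + m - int p) (k + i) \<and> walk x (n + m - int p) (k + i) p = k + j) \<longleftrightarrow>
      (\<exists>i. one x (n + m - int p) i \<and> walk x (n + m - int p) i p = k + j)" for p
    by (metis add_diff_cancel_left' diff_add_cancel add.commute)
  moreover have "walk x a b p - k = j \<longleftrightarrow> walk x a b p = k + j" for a b p
    by auto
  ultimately show ?thesis
    by (simp add: ancient_def add_diff_eq)
qed

lemma site_in_YL: "x \<in> XL \<Longrightarrow> site x n k \<in> YL \<longleftrightarrow> one x n k"
  using site_in_XL[of x n k] by (simp add: YL_def one_def site_def shiftZ2_def)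

lemma orbit_eq: "orbit x = {site x n k |n k. True}"
proof -
  have "\<exists>a b. site x n k = shiftZ2 a b x" for n k
    unfolding site_def by blast
  then show ?thesis
    unfolding orbit_def by (auto simp: shift_eq_site)
qed

section \<open>Walks\<close>

text \<open>The local rule of \<open>XL\<close>, read between consecutive antidiagonals.\<close>

lemma one_rule:
  assumes "x \<in> XL"
  shows "one x n k \<longleftrightarrow> one x (n + 1) k \<noteq> one x (n + 1) (k + 1)"
proof -
  have "x (k, n - k) + x (k + 1, n - k) + x (k, n - k + 1) = 0"
    using assms unfolding XL_def by blast
  moreover have e: "n + 1 - k = n - k + 1" "n + 1 - (k + 1) = n - k"
    by auto
  ultimately show ?thesis
    unfolding one_def e
    by (cases "x (k, n - k)"; cases "x (k + 1, n - k)"; cases "x (k, n - k + 1)") simp_all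
qed

lemma one_step: "x \<in> XL \<Longrightarrow> one x n k \<Longrightarrow> one x (n + 1) (step x n k)"
  using one_rule[of x n k] by (simp add: step_def)

lemma one_walk: "x \<in> XL \<Longrightarrow> one x n k \<Longrightarrow> one x (n + int p) (walk x n k p)"
proof (induction p)
  case (Suc p)
  then show ?case
    using one_step[of x "n + int p" "walk x n k p"] by (simp add: algebra_simps)
qed simp

text \<open>A step moves by 0 or 1, so paths cannot overtake each other: this is where planarity enters.\<close>

lemma step_mono: "j \<le> k \<Longrightarrow> step x n j \<le> step x n k"
  by (cases "j = k") (auto simp: step_def)

lemma walk_mono: "j \<le> k \<Longrightarrow> walk x n j p \<le> walk x n k p"
  by (induction p) (auto intro: step_mono)

lemma walk_add: "walk x n k (p + q) = walk x (n + int p) (walk x n k p) q"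
  by (induction q) (simp_all add: algebra_simps)

lemma walk_1: "walk x n k (Suc p) = walk x (n + 1) (step x n k) p"
  using walk_add[of x n k 1 p] by simp

lemma coalesce_refl [simp]: "coalesce x n k k"
  by (simp add: coalesce_def)

lemma coalesce_sym: "coalesce x n j k \<longleftrightarrow> coalesce x n k j"
  by (metis coalesce_def)

lemma walk_eq_later: "walk x n j p = walk x n k p \<Longrightarrow> p \<le> q \<Longrightarrow> walk x n j q = walk x n k q"
  using walk_add[of x n j p "q - p"] walk_add[of x n k p "q - p"] by simp

lemma coalesce_trans: 
  assumes "coalesce x n i j" "coalesce x n j k"
  shows "coalesce x n i k"
proof -
  obtain p q where "walk x n i p = walk x n j p" "walk x n j q = walk x n k q"
    using assms unfolding coalesce_def by blast
  then have "walk x n i (max p q) = walk x n j (max p q)" "walk x n j (max p q) = walk x n k (max p q)"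
    by (auto intro: walk_eq_later)
  then show ?thesis
    unfolding coalesce_def by metis
qed

lemma coalesce_common:
  assumes "coalesce x n i j" "coalesce x n i k"
  shows "coalesce x n j k"
  using coalesce_trans[of x n j i k] assms by (simp add: coalesce_sym)

lemma coalesce_common':
  assumes "coalesce x n i k" "coalesce x n j k"
  shows "coalesce x n i j"
  using coalesce_trans[of x n i k j] assms by (simp add: coalesce_sym)

lemma coalesce_between: "coalesce x n i k \<Longrightarrow> i \<le> j \<Longrightarrow> j \<le> k \<Longrightarrow> coalesce x n i j"
  unfolding coalesce_def by (metis walk_mono order_antisym)

lemma coalesce_walk: "coalesce x (n + int p) (walk x n j p) (walk x n k p) \<longleftrightarrow> coalesce x n j k"
proof
  assume "coalesce x n j k"
  then obtain q where "walk x n j q = walk x n k q"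
    unfolding coalesce_def by blast
  then have "walk x n j (p + q) = walk x n k (p + q)"
    by (rule walk_eq_later) simp
  then show "coalesce x (n + int p) (walk x n j p) (walk x n k p)"
    unfolding coalesce_def walk_add by blast
qed (auto simp: coalesce_def simp flip: walk_add)

lemma coalesce_step: "coalesce x (n + 1) (step x n j) (step x n k) \<longleftrightarrow> coalesce x n j k"
  using coalesce_walk[of x n 1] by simp

lemma sigmaL_site:
  assumes "x \<in> XL" "one x n k"
  shows "sigmaL (site x n k) = site x (n + 1) (step x n k)"
proof -
  have "shiftT (site x n k) = site x (n + 1) (k + 1)" "shiftS (site x n k) = site x (n + 1) k"
    by (simp_all add: shift_eq_site add.commute)
  then show ?thesis
    using assms by (simp add: sigmaL_def site_in_YL step_def)
qed

lemma sigmaL_pow_site: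
  assumes "x \<in> XL" "one x n k"
  shows "(sigmaL ^^ p) (site x n k) = site x (n + int p) (walk x n k p)"
proof (induction p)
  case (Suc p)
  then show ?case
    using sigmaL_site[OF assms(1) one_walk[OF assms, of p]] by (simp add: algebra_simps)
qed simp

section \<open>Rightmost ones\<close>

lemma rightmost_unique:
  assumes "rightmost x n i" "rightmost x n j" "coalesce x n i j"
  shows "i = j"
  using assms coalesce_sym by (metis rightmost_def linorder_neqE)

text \<open>
  A component bounded above on an antidiagonal has a greatest element there. The bound \<open>m\<close> is left
  abstract because it comes from a one of another component in some uses, and from an assumption to
  be refuted in others.
\<close>

lemma rightmost_exists:
  assumes "one x n k" and bound: "\<And>j. j > m \<Longrightarrow> one x n j \<Longrightarrow> \<not> coalesce x n k j"
  shows "\<exists>e\<ge>k. rightmost x n e \<and> coalesce x n k e"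
proof -
  define C where "C = {j. k \<le> j \<and> one x n j \<and> coalesce x n k j}"
  have "C \<subseteq> {k..m}"
    using bound by (force simp: C_def)
  then have fin: "finite C"
    by (rule finite_subset) simp
  have "k \<in> C"
    using assms(1) by (simp add: C_def)
  then have "Max C \<in> C" "k \<le> Max C"
    using fin by (auto intro: Max_in)
  moreover have "\<not> coalesce x n (Max C) j" if "j > Max C" "one x n j" for j
  proof
    assume "coalesce x n (Max C) j"
    then have "j \<in> C"
      using that \<open>Max C \<in> C\<close> by (auto simp: C_def intro: coalesce_trans)
    then show False
      using Max_ge[OF fin] that(1) by force
  qed
  ultimately show ?thesis
    by (auto simp: rightmost_def C_def)
qed

text \<open>
  A later one \<open>f\<close> does not coalesce with \<open>e\<close>, so the image of \<open>f\<close> bounds the component of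
  \<open>e\<close> on the next antidiagonal.
\<close>

lemma rightmost_next:
  assumes "x \<in> XL" "rightmost x n e" "one x n f" "e < f"
  shows "\<exists>e'. rightmost x (n + 1) e' \<and> coalesce x (n + 1) (step x n e) e'"
proof -
  have "\<not> coalesce x n e f" "one x n e"
    using assms by (auto simp: rightmost_def)
  moreover have "step x n e \<le> step x n f"
    using assms(4) by (intro step_mono) simp
  ultimately have "\<not> coalesce x (n + 1) (step x n e) j" if "j > step x n f" for j
    using that coalesce_between[of x "n + 1" "step x n e" j "step x n f"] by (auto simp: coalesce_step)
  then show ?thesis
    using rightmost_exists[OF one_step[OF assms(1) \<open>one x n e\<close>]] by blast
qed

lemma all_coalesce:
  assumes "\<And>e. \<not> rightmost x n e" "one x n j" "one x n k"
  shows "coalesce x n j k"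
proof -
  have *: "coalesce x n j k" if "j \<le> k" "one x n j" "one x n k" for j k
  proof (rule ccontr)
    assume "\<not> coalesce x n j k"
    then have "\<not> coalesce x n j i" if "i > k" for i
      using that \<open>j \<le> k\<close> coalesce_between[of x n j i k] by auto
    then show False
      using rightmost_exists[OF \<open>one x n j\<close>] assms(1) by blast
  qed
  then show ?thesis
    using assms(2,3) coalesce_sym[of x n j k] by (cases "j \<le> k") auto
qed

section \<open>Ancient ones\<close>

lemma ancient_one: "ancient x n k \<Longrightarrow> one x n k"
  unfolding ancient_def by (drule spec[of _ 0]) simp

lemma ancestors_antimono:
  assumes "x \<in> XL" "one x (n - int q) j" "walk x (n - int q) j q = k" "p \<le> q"
  shows "\<exists>i. one x (n - int p) i \<and> walk x (n - int p) i p = k"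
proof -
  let ?i = "walk x (n - int q) j (q - p)"
  have e: "n - int q + int (q - p) = n - int p"
    using assms(4) by simp
  have "one x (n - int p) ?i"
    using one_walk[OF assms(1,2), of "q - p"] by (simp only: e)
  moreover have "walk x (n - int p) ?i p = k"
    using walk_add[of x "n - int q" j "q - p" p] assms(3,4) by (simp add: e)
  ultimately show ?thesis
    by blast
qed

text \<open>
  Koenig's lemma in its weakest form: having an ancestor of generation \<open>p\<close> is inherited by smaller
  \<open>p\<close>, so if each member of \<open>F\<close> failed at some generation, all of them would fail at the largest
  of these generations.
\<close>

lemma ancient_pigeonhole:
  assumes "x \<in> XL" "finite F"
    and anc: "\<And>p. \<exists>i. one x (n - int p) i \<and> walk x (n - int p) i p \<in> F"
  shows "\<exists>k\<in>F. ancient x n k"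
proof (rule ccontr)
  assume "\<not> ?thesis"
  then have "\<forall>k\<in>F. \<exists>p. \<forall>i. one x (n - int p) i \<longrightarrow> walk x (n - int p) i p \<noteq> k"
    unfolding ancient_def by blast
  then obtain P where P: "\<And>k i. k \<in> F \<Longrightarrow> one x (n - int (P k)) i \<Longrightarrow> walk x (n - int (P k)) i (P k) \<noteq> k"
    by metis
  obtain i where i: "one x (n - int (Max (P ` F))) i" "walk x (n - int (Max (P ` F))) i (Max (P ` F)) \<in> F"
    using anc by blast
  let ?k = "walk x (n - int (Max (P ` F))) i (Max (P ` F))"
  have "P ?k \<le> Max (P ` F)"
    using i(2) \<open>finite F\<close> by simp
  then show False
    using ancestors_antimono[OF assms(1) i(1) refl] P[OF i(2)] by blast
qed

lemma ancient_step:
  assumes "x \<in> XL" "ancient x n k"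
  shows "ancient x (n + 1) (step x n k)"
  unfolding ancient_def
proof
  fix p
  obtain j where j: "one x (n - int p) j" "walk x (n - int p) j p = k"
    using assms(2) unfolding ancient_def by blast
  then have "walk x (n + 1 - int (Suc p)) j (Suc p) = step x n k"
    by (simp add: algebra_simps)
  moreover have "one x (n + 1 - int (Suc p)) j"
    using j by (simp add: algebra_simps)
  ultimately show "\<exists>j. one x (n + 1 - int p) j \<and> walk x (n + 1 - int p) j p = step x n k"
    by (intro ancestors_antimono[OF assms(1), of _ "Suc p"]) auto
qed

lemma ancient_walk:
  assumes "x \<in> XL" "ancient x n k"
  shows "ancient x (n + int p) (walk x n k p)"
proof (induction p)
  case (Suc p)
  then show ?case
    using ancient_step[OF assms(1)] by (fastforce simp: algebra_simps)
qed (use assms in simp)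

lemma ancient_antecedent:
  assumes "x \<in> XL" "ancient x n k"
  shows "\<exists>j. ancient x (n - 1) j \<and> step x (n - 1) j = k"
proof -
  let ?F = "{j. j \<in> {k - 1..k} \<and> step x (n - 1) j = k}"
  have "\<exists>i. one x (n - 1 - int p) i \<and> walk x (n - 1 - int p) i p \<in> ?F" for p
  proof -
    obtain i where "one x (n - int (Suc p)) i" "walk x (n - int (Suc p)) i (Suc p) = k"
      using assms(2) unfolding ancient_def by blast
    then have i: "one x (n - 1 - int p) i" "step x (n - 1) (walk x (n - 1 - int p) i p) = k"
      by (simp_all add: algebra_simps)
    then have "walk x (n - 1 - int p) i p \<in> ?F"
      by (auto simp: step_def split: if_splits)
    with i show ?thesis
      by blast
  qed
  moreover have "finite ?F"
    by (rule finite_subset[of _ "{k - 1..k}"]) auto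
  ultimately show ?thesis
    using ancient_pigeonhole[OF assms(1), of ?F "n - 1"] by blast
qed

lemma ancient_antecedents:
  assumes "x \<in> XL" "ancient x n k"
  shows "\<exists>j. ancient x (n - int p) j \<and> walk x (n - int p) j p = k"
proof (induction p)
  case 0
  show ?case
    using assms(2) by simp
next
  case (Suc p)
  then obtain j where j: "ancient x (n - int p) j" "walk x (n - int p) j p = k"
    by blast
  then obtain i where i: "ancient x (n - int p - 1) i" "step x (n - int p - 1) i = j"
    using ancient_antecedent[OF assms(1)] by blast
  have e: "n - int (Suc p) = n - int p - 1"
    by simp
  have "walk x (n - int p - 1) i (Suc p) = k"
    unfolding walk_1 using i j by simp
  then show ?case
    unfolding e using i(1) by blast
qed

text \<open>
  Going back along rightmost ones, the component of \<open>e\<close> is alive on all earlier antidiagonals, and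
  following its members forward they arrive at sites of the component on antidiagonal \<open>n\<close>. These
  sites lie between \<open>l\<close>, a rightmost one of another component, and \<open>e\<close>, so they are finite in
  number and the pigeonhole principle applies.
\<close>

lemma bounded_component_meets_ancient:
  assumes "x \<in> XL" and anc: "\<And>n e. rightmost x n e \<Longrightarrow> \<exists>d. rightmost x (n - 1) d \<and> coalesce x n (step x (n - 1) d) e"
    and l: "rightmost x n l" "l < e" and e: "rightmost x n e"
  shows "\<exists>j. ancient x n j \<and> coalesce x n j e"
proof -
  have gen: "\<exists>d. rightmost x (n - int p) d \<and> coalesce x n (walk x (n - int p) d p) e" for p
  proof (induction p)
    case 0
    show ?case
      using e by auto
  next
    case (Suc p)
    then obtain d where d: "rightmost x (n - int p) d" "coalesce x n (walk x (n - int p) d p) e"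
      by blast
    then obtain c where c: "rightmost x (n - int p - 1) c" "coalesce x (n - int p) (step x (n - int p - 1) c) d"
      using anc by blast
    have "coalesce x n (walk x (n - int p) (step x (n - int p - 1) c) p) (walk x (n - int p) d p)"
      using c(2) coalesce_walk[of x "n - int p" p] by simp
    then have "coalesce x n (walk x (n - int p - 1) c (Suc p)) e"
      unfolding walk_1 using d(2) coalesce_trans by simp
    moreover have e: "n - int (Suc p) = n - int p - 1"
      by simp
    ultimately show ?case
      unfolding e using c(1) by blast
  qed
  let ?F = "{j \<in> {l<..e}. coalesce x n j e}"
  have "\<exists>i. one x (n - int p) i \<and> walk x (n - int p) i p \<in> ?F" for p
  proof -
    obtain d where d: "rightmost x (n - int p) d" "coalesce x n (walk x (n - int p) d p) e"
      using gen by blast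
    let ?w = "walk x (n - int p) d p"
    have "one x (n - int p) d"
      using d by (simp add: rightmost_def)
    then have "one x n ?w"
      using one_walk[OF assms(1), of "n - int p" d p] by simp
    then have "?w \<le> e"
      using e d(2) coalesce_sym unfolding rightmost_def by (metis not_le)
    moreover have "l < ?w"
    proof (rule ccontr)
      assume "\<not> l < ?w"
      then have "coalesce x n ?w l"
        using coalesce_between[OF d(2)] l(2) by simp
      then have "coalesce x n l e"
        using d(2) coalesce_sym coalesce_trans by metis
      then show False
        using l e by (simp add: rightmost_def)
    qed
    ultimately show ?thesis
      using d \<open>one x (n - int p) d\<close> by auto
  qed
  moreover have "finite ?F"
    by (rule finite_subset[of _ "{l<..e}"]) auto
  ultimately show ?thesis
    using ancient_pigeonhole[OF assms(1), of ?F n] by blast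
qed


section \<open>Points with periods\<close>

definition free_orbit :: "config \<Rightarrow> bool" where
  "free_orbit x \<longleftrightarrow> (\<forall>n k. site x n k = x \<longrightarrow> n = 0 \<and> k = 0)"

lemma site_inj:
  assumes "free_orbit x" "site x n k = site x m j"
  shows "n = m \<and> k = j"
proof -
  have "site (site x n k) (- m) (- j) = site (site x m j) (- m) (- j)"
    using assms(2) by (rule arg_cong)
  then have "site x (n - m) (k - j) = x"
    by simp
  then have "n - m = 0 \<and> k - j = 0"
    using assms(1) unfolding free_orbit_def by blast
  then show ?thesis
    by simp
qed

lemma bit_double [simp]: "(a::bit) + a = 0"
  by (cases a) simp_all

lemma bit_add_eq_0: "(a::bit) + b = 0 \<longleftrightarrow> a = b"
  by (cases a; cases b) simp_all

lemma finite_bit: "finite (UNIV :: bit set)"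
  by (rule finite_subset[of _ "{0, 1}"]) auto

lemma sum_bit_sym_diff:
  fixes f :: "'a \<Rightarrow> bit"
  assumes "finite S" "finite T"
  shows "sum f (S - T \<union> (T - S)) = sum f S + sum f T"
proof -
  have "sum f S = sum f (S - T) + sum f (S \<inter> T)" "sum f T = sum f (T - S) + sum f (S \<inter> T)"
    using sum.Int_Diff[of S f T] sum.Int_Diff[of T f S] assms by (simp_all only: add.commute Int_commute)
  moreover have "sum f (S - T \<union> (T - S)) = sum f (S - T) + sum f (T - S)"
    using assms by (intro sum.union_disjoint) auto
  moreover have "a + b = (a + c) + (b + c)" for a b c :: bit
    by (cases a; cases b; cases c) simp_all
  ultimately show ?thesis
    by metis
qed

text \<open>
  Since the row above is \<open>(1 + U)\<close> times a row, where \<open>U\<close> is the shift, row \<open>b\<close> is obtained by the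
  polynomial \<open>(1 + U)\<^sup>b\<close> over \<open>\<int>/2\<int>\<close>. The set \<open>S\<close> is its support; the extreme
  terms \<open>1\<close> and \<open>U\<^sup>b\<close> never cancel.
\<close>

lemma row_mask:
  "\<exists>S. finite S \<and> 0 \<in> S \<and> int b \<in> S \<and> S \<subseteq> {0..int b} \<and>
    (\<forall>x\<in>XL. \<forall>k l. x (k, l + int b) = (\<Sum>i\<in>S. x (k + i, l)))"
proof (induction b)
  case 0
  show ?case
    by (intro exI[of _ "{0}"]) simp
next
  case (Suc b)
  then obtain S where S: "finite S" "0 \<in> S" "int b \<in> S" "S \<subseteq> {0..int b}"
    and eq: "\<And>x k l. x \<in> XL \<Longrightarrow> x (k, l + int b) = (\<Sum>i\<in>S. x (k + i, l))"
    by metis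
  let ?T = "(+) 1 ` S"
  let ?U = "S - ?T \<union> (?T - S)"
  have U: "x (k, l + int (Suc b)) = (\<Sum>i\<in>?U. x (k + i, l))" if x: "x \<in> XL" for x k l
  proof -
    have "x (k, l + int b) + x (k + 1, l + int b) + x (k, l + int b + 1) = 0"
      using x unfolding XL_def by blast
    then have "x (k, l + int (Suc b)) = x (k, l + int b) + x (k + 1, l + int b)"
      by (simp add: bit_add_eq_0 add_ac)
    also have "\<dots> = (\<Sum>i\<in>S. x (k + i, l)) + (\<Sum>i\<in>?T. x (k + i, l))"
      using eq[OF x] by (simp add: sum.reindex add_ac)
    also have "\<dots> = (\<Sum>i\<in>?U. x (k + i, l))"
      using S(1) by (intro sum_bit_sym_diff[symmetric]) auto
    finally show ?thesis .
  qed
  have T: "?T \<subseteq> {1..int b + 1}" "int b + 1 \<in> ?T"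
    using S(3,4) by auto
  then have "0 \<notin> ?T" "int b + 1 \<notin> S"
    using S(4) by auto
  then have mem: "0 \<in> ?U" "int (Suc b) \<in> ?U"
    using S(2) T(2) by (simp_all add: add.commute)
  have "?U \<subseteq> S \<union> ?T"
    by blast
  then have sub: "?U \<subseteq> {0..int (Suc b)}"
    using S(4) T(1) by fastforce
  have fin: "finite ?U"
    using S(1) by simp
  show ?case
    using U mem sub fin by (intro exI[of _ ?U] conjI ballI allI)
qed

lemma recurrence_vanish:
  fixes d :: "int \<Rightarrow> bit"
  assumes S: "finite S" "S \<noteq> {}" and eq: "\<And>k. (\<Sum>i\<in>S. d (k + i)) = 0"
    and window: "\<And>k. 0 \<le> k \<Longrightarrow> k < Max S - Min S \<Longrightarrow> d k = 0"
  shows "d k = 0"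
proof -
  have solve: "d (k + i) = 0" if "i \<in> S" "\<And>j. j \<in> S \<Longrightarrow> j \<noteq> i \<Longrightarrow> d (k + j) = 0" for k i
  proof -
    have "(\<Sum>i\<in>S. d (k + i)) = d (k + i) + (\<Sum>j\<in>S - {i}. d (k + j))"
      using S(1) that(1) by (rule sum.remove)
    moreover have "(\<Sum>j\<in>S - {i}. d (k + j)) = 0"
      using that(2) by (intro sum.neutral) auto
    ultimately show ?thesis
      using eq[of k] by simp
  qed
  have right: "d (int n) = 0" for n
  proof (induction n rule: less_induct)
    case (less n)
    show ?case
    proof (cases "int n < Max S - Min S")
      case False
      have "d (int n - Max S + Max S) = 0"
      proof (rule solve)
        fix j assume j: "j \<in> S" "j \<noteq> Max S"
        then have "j < Max S" "Min S \<le> j"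
          using S(1) by (auto simp: order.strict_iff_order)
        then have "d (int (nat (int n - Max S + j))) = 0"
          using False by (intro less.IH) auto
        moreover have "0 \<le> int n - Max S + j"
          using False \<open>Min S \<le> j\<close> by simp
        ultimately show "d (int n - Max S + j) = 0"
          by simp
      qed (use S in simp)
      then show ?thesis
        by simp
    qed (use window in simp)
  qed
  have left: "d (- int n) = 0" for n
  proof (induction n rule: less_induct)
    case (less n)
    have "d (- int n - Min S + Min S) = 0"
    proof (rule solve)
      fix j assume j: "j \<in> S" "j \<noteq> Min S"
      then have "Min S < j"
        using S(1) by (auto simp: order.strict_iff_order)
      show "d (- int n - Min S + j) = 0"
      proof (cases "- int n - Min S + j \<ge> 0")
        case True
        then show ?thesis
          using right[of "nat (- int n - Min S + j)"] by simp
      next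
        case False
        then have "d (- int (nat (- (- int n - Min S + j)))) = 0"
          using \<open>Min S < j\<close> by (intro less.IH) auto
        moreover have "- int (nat (- (- int n - Min S + j))) = - int n - Min S + j"
          using False by simp
        ultimately show ?thesis
          by (simp only:)
      qed
    qed (use S in simp)
    then show ?case
      by simp
  qed
  show ?thesis
    using right[of "nat k"] left[of "nat (- k)"] by (cases "k \<ge> 0") auto
qed

text \<open>
  A nonzero linear recurrence over \<open>\<int>/2\<int>\<close> has invertible extreme coefficients, so its solutions
  are determined, in both directions, by a window of finite length.
\<close>

lemma finite_recurrence:
  assumes S: "finite S" "S \<noteq> {}"
  shows "finite {r :: int \<Rightarrow> bit. \<forall>k. (\<Sum>i\<in>S. r (k + i)) = 0}" (is "finite ?K")
proof (rule inj_on_finite)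
  let ?W = "{0..<Max S - Min S}"
  show "inj_on (\<lambda>r. restrict r ?W) ?K"
  proof (rule inj_onI)
    fix r s assume r: "r \<in> ?K" "s \<in> ?K" and eq: "restrict r ?W = restrict s ?W"
    have "r k + s k = 0" for k
    proof (rule recurrence_vanish[OF S, where d = "\<lambda>k. r k + s k"])
      show "(\<Sum>i\<in>S. r (k + i) + s (k + i)) = 0" for k
        unfolding sum.distrib using r by auto
      show "r k + s k = 0" if "0 \<le> k" "k < Max S - Min S" for k
      proof -
        have "restrict r ?W k = restrict s ?W k"
          using eq by simp
        then show ?thesis
          using that by (simp add: bit_add_eq_0)
      qed
    qed
    then show "r = s"
      unfolding bit_add_eq_0 by (rule ext)
  qed
  show "(\<lambda>r. restrict r ?W) ` ?K \<subseteq> ?W \<rightarrow>\<^sub>E UNIV"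
    by auto
  show "finite (?W \<rightarrow>\<^sub>E (UNIV :: bit set))"
    by (intro finite_PiE finite_bit) auto
qed

text \<open>
  A period \<open>(a, b)\<close> identifies row \<open>b\<close> with a translate of row \<open>0\<close>, so row \<open>0\<close> is annihilated by
  \<open>(1 + U)\<^sup>b + U\<^bsup>-a\<^esup>\<close>, which is nonzero since \<open>(1 + U)\<^sup>b\<close> has at least two terms. There
  are finitely many such rows, and row \<open>0\<close> determines the rows above it and, by periodicity, all of
  them.
\<close>

lemma finite_periodic_up:
  assumes "b \<ge> 1"
  shows "finite {x \<in> XL. \<forall>k l. x (k + a, l + int b) = x (k, l)}" (is "finite ?P")
proof -
  obtain S where S: "finite S" "0 \<in> S" "int b \<in> S"
    and "\<forall>x\<in>XL. \<forall>k l. x (k, l + int b) = (\<Sum>i\<in>S. x (k + i, l))"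
    using row_mask[of b] by blast
  then have eq: "x (k, l + int b) = (\<Sum>i\<in>S. x (k + i, l))" if "x \<in> XL" for x k l
    using that by blast
  let ?U = "S - {- a} \<union> ({- a} - S)"
  have fin: "finite {r :: int \<Rightarrow> bit. \<forall>k. (\<Sum>i\<in>?U. r (k + i)) = 0}" (is "finite ?K")
  proof (rule finite_recurrence)
    have "int b \<noteq> 0"
      using assms by simp
    then have "0 \<in> ?U \<or> int b \<in> ?U"
      using S(2,3) by (cases "a = 0") simp_all
    then show "?U \<noteq> {}"
      by (metis empty_iff)
  qed (use S in simp)
  show ?thesis
  proof (rule inj_on_finite[OF _ _ fin])
    show "(\<lambda>x k. x (k, 0)) ` ?P \<subseteq> ?K"
    proof clarsimp
      fix x k assume x: "x \<in> XL" "\<forall>k l. x (k + a, l + int b) = x (k, l)"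
      have "(\<Sum>i\<in>?U. x (k + i, 0)) = (\<Sum>i\<in>S. x (k + i, 0)) + (\<Sum>i\<in>{- a}. x (k + i, 0))"
        using S(1) by (intro sum_bit_sym_diff) auto
      also have "\<dots> = x (k, 0 + int b) + x (k - a, 0)"
        using eq[OF x(1), of k 0] by simp
      also have "\<dots> = 0"
        using x(2)[rule_format, of "k - a" 0] by (simp add: bit_add_eq_0)
      finally show "(\<Sum>i\<in>?U. x (k + i, 0)) = 0" .
    qed
    show "inj_on (\<lambda>x k. x (k, 0)) ?P"
    proof (rule inj_onI)
      fix x y assume x: "x \<in> ?P" and y: "y \<in> ?P" and row: "(\<lambda>k. x (k, 0)) = (\<lambda>k. y (k, 0))"
      have up: "\<forall>k. x (k, int n) = y (k, int n)" for n
      proof (induction n)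
        case 0
        then show ?case
          using row by (simp add: fun_eq_iff)
      next
        case (Suc n)
        have "z (k, int (Suc n)) = z (k, int n) + z (k + 1, int n)" if "z \<in> XL" for z k
        proof -
          have "z (k, int n) + z (k + 1, int n) + z (k, int n + 1) = 0"
            using that unfolding XL_def by blast
          then show ?thesis
            by (simp add: bit_add_eq_0 add_ac)
        qed
        moreover have "x \<in> XL" "y \<in> XL"
          using x y by simp_all
        moreover have "\<forall>k. x (k, int n) = y (k, int n)"
          by (rule Suc.IH)
        ultimately show ?case
          by metis
      qed
      have per: "z (k, l) = z (k + int t * a, l + int t * int b)" if "z \<in> ?P" for z k l t
      proof (induction t)
        case (Suc t)
        have "z (k + int t * a + a, l + int t * int b + int b) = z (k + int t * a, l + int t * int b)"
          using that by blast
        moreover have "k + int t * a + a = k + int (Suc t) * a" "l + int t * int b + int b = l + int (Suc t) * int b"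
          by (simp_all add: algebra_simps)
        ultimately show ?case
          using Suc by (simp only:)
      qed simp
      have "x (k, l) = y (k, l)" for k l
      proof -
        let ?t = "nat (- l)"
        have "int ?t * 1 \<le> int ?t * int b"
          using assms by (intro mult_left_mono) auto
        then have "0 \<le> l + int ?t * int b"
          by linarith
        then have "x (k + int ?t * a, l + int ?t * int b) = y (k + int ?t * a, l + int ?t * int b)"
          using up[of "nat (l + int ?t * int b)"] by simp
        then show ?thesis
          using per[OF x, of k l ?t] per[OF y, of k l ?t] by simp
      qed
      then show "x = y"
        by (auto simp: fun_eq_iff)
    qed
  qed
qed

text \<open>
  The rule of \<open>XL\<close> is symmetric in its coordinates, which reduces horizontal periods to vertical ones.
\<close>

lemma finite_periodic:
  assumes "(a, b) \<noteq> (0, 0)"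
  shows "finite {x \<in> XL. \<forall>k l. x (k + a, l + b) = x (k, l)}"
proof -
  have pos: "finite {x \<in> XL. \<forall>k l. x (k + a, l + b) = x (k, l)}" if "b > 0" for a b
    using finite_periodic_up[of "nat b" a] that by simp
  have nonzero: "finite {x \<in> XL. \<forall>k l. x (k + a, l + b) = x (k, l)}" if "b \<noteq> 0" for a b
  proof (cases "b > 0")
    case False
    have "x (k + - a, l + - b) = x (k, l)" if "\<forall>k l. x (k + a, l + b) = x (k, l)" for x :: config and k l
      using that[rule_format, of "k - a" "l - b"] by simp
    then have "{x \<in> XL. \<forall>k l. x (k + a, l + b) = x (k, l)} \<subseteq> {x \<in> XL. \<forall>k l. x (k + - a, l + - b) = x (k, l)}"
      by blast
    moreover have "- b > 0"
      using False that by simp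
    ultimately show ?thesis
      using finite_subset[OF _ pos[of "- b" "- a"]] by blast
  qed (rule pos)
  show ?thesis
  proof (cases "b = 0")
    case True
    then have "a \<noteq> 0"
      using assms by simp
    have swap: "x \<circ> prod.swap \<in> XL" if "x \<in> XL" for x
    proof -
      have "x (l, k) + x (l + 1, k) + x (l, k + 1) = 0" for k l
        using that unfolding XL_def by blast
      then have "x (l, k) + x (l, k + 1) + x (l + 1, k) = 0" for k l
        by (subst add.assoc, subst add.commute[of "x (l, k + 1)"]) (simp only: add.assoc)
      then show ?thesis
        unfolding XL_def by simp
    qed
    have "{x \<in> XL. \<forall>k l. x (k + a, l + b) = x (k, l)} \<subseteq>
        (\<lambda>x. x \<circ> prod.swap) ` {x \<in> XL. \<forall>k l. x (k + b, l + a) = x (k, l)}"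
    proof (rule subsetI)
      fix x assume x: "x \<in> {x \<in> XL. \<forall>k l. x (k + a, l + b) = x (k, l)}"
      then have "x = (x \<circ> prod.swap) \<circ> prod.swap" "x \<circ> prod.swap \<in> XL"
        "\<forall>k l. (x \<circ> prod.swap) (k + b, l + a) = (x \<circ> prod.swap) (k, l)"
        using swap by (auto simp: comp_assoc)
      then show "x \<in> (\<lambda>x. x \<circ> prod.swap) ` {x \<in> XL. \<forall>k l. x (k + b, l + a) = x (k, l)}"
        by blast
    qed
    then show ?thesis
      using nonzero[OF \<open>a \<noteq> 0\<close>] finite_surj by blast
  qed (rule nonzero)
qed

lemma walk_bounds: "k \<le> walk x n k p \<and> walk x n k p \<le> k + int p"
  by (induction p) (auto simp: step_def)

lemma sigma_fibre:
  assumes "x \<in> XL"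
  shows "{y \<in> YL. (sigmaL ^^ p) y = x} =
    site x (- int p) ` {j. one x (- int p) j \<and> walk x (- int p) j p = 0}"
proof (intro set_eqI iffI)
  fix y assume "y \<in> {y \<in> YL. (sigmaL ^^ p) y = x}"
  then have y: "y \<in> XL" "one y 0 0" "(sigmaL ^^ p) y = x"
    using site_in_YL[of y 0 0] by (auto simp: YL_def)
  let ?w = "walk y 0 0 p"
  have x: "x = site y (int p) ?w"
    using sigmaL_pow_site[OF y(1,2), of p] y(3) by simp
  then have "y = site x (- int p) (- ?w)" "one x (- int p) (- ?w)" "walk x (- int p) (- ?w) p = 0"
    using y(2) by simp_all
  then show "y \<in> site x (- int p) ` {j. one x (- int p) j \<and> walk x (- int p) j p = 0}"
    by blast
qed (use assms in \<open>auto simp: sigmaL_pow_site site_in_YL\<close>)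

lemma finite_sigma_fibre:
  assumes "x \<in> XL"
  shows "finite {y \<in> YL. (sigmaL ^^ p) y = x}"
proof -
  have "j \<in> {- int p..0}" if "walk x (- int p) j p = 0" for j
    using walk_bounds[of j x "- int p" p] that by simp
  then have "{j. one x (- int p) j \<and> walk x (- int p) j p = 0} \<subseteq> {- int p..0}"
    by blast
  then show ?thesis
    unfolding sigma_fibre[OF assms] using finite_subset by blast
qed

text \<open>
  Every generation of antecedents is finite, so infinitely many antecedents require all generations
  to be nonempty. Conversely, ancestors of different generations lie on different antidiagonals,
  and they are different points because the orbit is free.
\<close>

lemma ZL_iff_ancient:
  assumes "x \<in> XL" "free_orbit x"
  shows "x \<in> ZL \<longleftrightarrow> ancient x 0 0"
proof
  assume x: "x \<in> ZL"
  show "ancient x 0 0"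
    unfolding ancient_def
  proof (rule ccontr)
    assume "\<not> (\<forall>p. \<exists>j. one x (0 - int p) j \<and> walk x (0 - int p) j p = 0)"
    then obtain p where p: "\<And>j. one x (0 - int p) j \<Longrightarrow> walk x (0 - int p) j p \<noteq> 0"
      by blast
    then have "{y \<in> YL. (sigmaL ^^ q) y = x} = {}" if "p \<le> q" for q
      unfolding sigma_fibre[OF assms(1)] using ancestors_antimono[OF assms(1), of 0 q _ 0 p] that by auto
    then have "antecedents x \<subseteq> (\<Union>q\<in>{..<p}. {y \<in> YL. (sigmaL ^^ q) y = x})"
      unfolding antecedents_def by (fastforce simp: not_less[symmetric])
    moreover have "finite (\<Union>q\<in>{..<p}. {y \<in> YL. (sigmaL ^^ q) y = x})"
      using finite_sigma_fibre[OF assms(1)] by blast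
    ultimately show False
      using x finite_subset unfolding ZL_def by blast
  qed
next
  assume a: "ancient x 0 0"
  then obtain j where j: "\<And>p. one x (- int p) (j p) \<and> walk x (- int p) (j p) p = 0"
    unfolding ancient_def by simp metis
  let ?f = "\<lambda>p. site x (- int (Suc p)) (j (Suc p))"
  have "inj ?f"
    by (rule injI) (use site_inj[OF assms(2)] in force)
  moreover have "range ?f \<subseteq> antecedents x"
  proof clarify
    fix p
    have "?f p \<in> {y \<in> YL. (sigmaL ^^ Suc p) y = x}"
      unfolding sigma_fibre[OF assms(1)] using j by blast
    then show "?f p \<in> antecedents x"
      unfolding antecedents_def by (intro UN_I[of "Suc p"]) auto
  qed
  ultimately have "infinite (antecedents x)"
    using finite_subset range_inj_infinite by blast
  moreover have "x \<in> YL"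
    using site_in_YL[OF assms(1), of 0 0] ancient_one[OF a] by simp
  ultimately show "x \<in> ZL"
    by (simp add: ZL_def)
qed

section \<open>Measurability\<close>

lemma pred_one [measurable]: "Measurable.pred borel (\<lambda>x. one x n k)"
proof -
  have "closed {x::config. x (k, n - k) = 1}"
    by (intro closed_Collect_eq continuous_on_product_coordinates continuous_on_const)
  then show ?thesis
    by (simp add: pred_def one_def)
qed

lemma pred_walk [measurable]: "Measurable.pred borel (\<lambda>x. walk x n k p = j)"
proof (induction p arbitrary: j)
  case (Suc p)
  have "walk x n k (Suc p) = j \<longleftrightarrow> walk x n k p = j - 1 \<and> one x (n + int p + 1) j \<or>
      walk x n k p = j \<and> \<not> one x (n + int p + 1) (j + 1)" for x
    by (auto simp: step_def)
  then show ?case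
    using Suc by (simp del: walk.simps)
qed simp

lemma pred_coalesce [measurable]: "Measurable.pred borel (\<lambda>x. coalesce x n j k)"
proof -
  have "coalesce x n j k \<longleftrightarrow> (\<exists>p i. walk x n j p = i \<and> walk x n k p = i)" for x
    unfolding coalesce_def by metis
  moreover have "Measurable.pred borel (\<lambda>x. \<exists>p i. walk x n j p = i \<and> walk x n k p = i)"
    by measurable
  ultimately show ?thesis
    by simp
qed

lemma pred_coalesce_step [measurable]: "Measurable.pred borel (\<lambda>x. coalesce x m (step x n i) j)"
proof -
  have "coalesce x m (step x n i) j \<longleftrightarrow> one x (n + 1) (i + 1) \<and> coalesce x m (i + 1) j \<or>
      \<not> one x (n + 1) (i + 1) \<and> coalesce x m i j" for x
    by (simp add: step_def)
  then show ?thesis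
    by simp
qed

lemma pred_rightmost [measurable]: "Measurable.pred borel (\<lambda>x. rightmost x n k)"
  unfolding rightmost_def by measurable

lemma pred_ancient [measurable]: "Measurable.pred borel (\<lambda>x. ancient x n k)"
  unfolding ancient_def by measurable

lemma pred_site:
  assumes "Measurable.pred borel Q"
  shows "Measurable.pred borel (\<lambda>x. Q (site x n k))"
  unfolding site_def using measurable_compose[OF measurable_shift assms] .

section \<open>Invariant measures\<close>

locale invariant_prob = prob_space \<mu> for \<mu> :: "config measure" +
  assumes sets_eq: "sets \<mu> = sets borel_XL"
    and invariant: "invariant_measure \<mu>"
begin

lemma space_eq: "space \<mu> = XL"
  using sets_eq_imp_space_eq[OF sets_eq] by (simp add: borel_XL_def space_restrict_space)

lemma sets_Collect: "Measurable.pred borel Q \<Longrightarrow> {x \<in> XL. Q x} \<in> sets \<mu>"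
  using borel_closed[OF closed_XL] sets.Int[of XL borel "{x. Q x}"]
  by (simp add: sets_eq sets_borel_XL pred_def Int_def)

lemma measurable_site: "(\<lambda>x. site x n k) \<in> measurable \<mu> \<mu>"
  using measurable_shift_XL[of k "n - k"] measurable_cong_sets[OF sets_eq sets_eq]
  by (simp add: site_def[abs_def])

lemma distr_site: "distr \<mu> \<mu> (\<lambda>x. site x n k) = \<mu>"
  using invariant by (simp add: invariant_measure_def site_def[abs_def])

lemma AE_site:
  assumes "AE x in \<mu>. P x"
  shows "AE x in \<mu>. \<forall>n k. P (site x n k)"
proof -
  have "AE x in \<mu>. P (site x n k)" for n k
    using AE_distrD[OF measurable_site[of n k], of P] assms unfolding distr_site by blast
  then show ?thesis
    by (simp add: AE_all_countable)
qed

lemma emeasure_site: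
  assumes "A \<in> sets \<mu>"
  shows "emeasure \<mu> {x \<in> XL. site x n k \<in> A} = emeasure \<mu> A"
proof -
  have "emeasure \<mu> A = emeasure (distr \<mu> \<mu> (\<lambda>x. site x n k)) A"
    by (simp add: distr_site)
  also have "\<dots> = emeasure \<mu> ((\<lambda>x. site x n k) -` A \<inter> space \<mu>)"
    using assms by (intro emeasure_distr measurable_site)
  also have "(\<lambda>x. site x n k) -` A \<inter> space \<mu> = {x \<in> XL. site x n k \<in> A}"
    by (auto simp: space_eq)
  finally show ?thesis
    by simp
qed

lemma AE_not_iff_null:
  assumes "Measurable.pred borel Q"
  shows "(AE x in \<mu>. \<not> Q x) \<longleftrightarrow> emeasure \<mu> {x \<in> XL. Q x} = 0"
  using AE_iff_measurable[OF sets_Collect[OF assms], of "\<lambda>x. \<not> Q x"] by (simp add: space_eq)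

lemma AE_in_XL: "AE x in \<mu>. x \<in> XL"
  using AE_space space_eq by auto

text \<open>Removing the countably many translates of a null set leaves an invariant set of full measure.\<close>

lemma invariant_full_set:
  assumes "AE x in \<mu>. P x"
  shows "\<exists>B\<in>sets \<mu>. Z2_invariant B \<and> measure \<mu> B = 1 \<and> (\<forall>x\<in>B. x \<in> XL \<and> P x)"
proof -
  obtain N where N: "N \<in> null_sets \<mu>" "{x \<in> space \<mu>. \<not> P x} \<subseteq> N"
    using assms by (auto simp: eventually_ae_filter)
  define B where "B = {x \<in> XL. \<forall>n k. site x n k \<notin> N}"
  have "{x \<in> XL. site x n k \<notin> N} \<in> sets \<mu>" for n k
  proof -
    have "(\<lambda>x. site x n k) -` (space \<mu> - N) \<inter> space \<mu> \<in> sets \<mu>"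
      using N(1) by (intro measurable_sets[OF measurable_site]) auto
    moreover have "(\<lambda>x. site x n k) -` (space \<mu> - N) \<inter> space \<mu> = {x \<in> XL. site x n k \<notin> N}"
      by (auto simp: space_eq site_in_XL)
    ultimately show ?thesis
      by simp
  qed
  then have "(\<Inter>n. \<Inter>k. {x \<in> XL. site x n k \<notin> N}) \<in> sets \<mu>"
    by (intro sets.countable_INT' image_subsetI) auto
  moreover have "(\<Inter>n. \<Inter>k. {x \<in> XL. site x n k \<notin> N}) = B"
    by (auto simp: B_def)
  ultimately have B: "B \<in> sets \<mu>"
    by simp
  have "AE x in \<mu>. \<forall>n k. site x n k \<notin> N"
    by (intro AE_site AE_not_in N(1))
  then have "AE x in \<mu>. x \<in> B"
    using AE_in_XL by eventually_elim (simp add: B_def)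
  then have "measure \<mu> B = 1"
    using prob_eq_1[OF B] by simp
  moreover have "Z2_invariant B"
  proof -
    have sub: "shiftZ2 a b ` B \<subseteq> B" for a b
      by (auto simp: B_def shift_eq_site site_in_XL)
    moreover have "B \<subseteq> shiftZ2 a b ` B" for a b
    proof
      fix x assume "x \<in> B"
      then have "shiftZ2 (- a) (- b) x \<in> B" "x = shiftZ2 a b (shiftZ2 (- a) (- b) x)"
        using sub by (auto simp: shift_add shift_zero)
      then show "x \<in> shiftZ2 a b ` B"
        by blast
    qed
    ultimately show ?thesis
      unfolding Z2_invariant_def by blast
  qed
  moreover have "x \<in> XL \<and> P x" if "x \<in> B" for x
  proof -
    have "site x 0 0 \<notin> N" "x \<in> XL"
      using that unfolding B_def by blast+
    then show ?thesis
      using N(2) by (auto simp: space_eq)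
  qed
  ultimately show ?thesis
    using B by blast
qed

text \<open>
  A one-sided bound would single out a last visit. The translates of the event that the last visit
  happens at a given time are disjoint and have the same measure, so this measure is zero. The factor
  \<open>s\<close> is \<open>1\<close> or \<open>- 1\<close> in the applications, for the two directions along an antidiagonal.
\<close>

lemma AE_recurrent:
  assumes Q: "Measurable.pred borel Q"
  shows "AE x in \<mu>. \<forall>k. Q (site x 0 (s * k)) \<longrightarrow> (\<forall>m. \<exists>j>m. Q (site x 0 (s * j)))"
proof -
  define L where "L x \<longleftrightarrow> Q x \<and> (\<forall>k>0. \<not> Q (site x 0 (s * k)))" for x
  note [measurable] = pred_site[OF Q] Q
  have L: "Measurable.pred borel L"
    unfolding L_def[abs_def] by measurable
  let ?A = "\<lambda>i. {x \<in> XL. site x 0 (s * int i) \<in> {x \<in> XL. L x}}"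
  have "?A i = {x \<in> XL. L (site x 0 (s * int i))}" for i
    by (auto simp: site_in_XL)
  then have sets: "range ?A \<subseteq> sets \<mu>"
    using sets_Collect[OF pred_site[OF L]] by auto
  have "?A i \<inter> ?A j = {}" if "i < j" for i j
  proof -
    have "False" if "x \<in> ?A i \<inter> ?A j" for x
    proof -
      have "\<not> Q (site (site x 0 (s * int i)) 0 (s * int (j - i)))" "Q (site x 0 (s * int j))"
        using that \<open>i < j\<close> unfolding L_def by auto
      moreover have "s * int i + s * int (j - i) = s * int j"
        using \<open>i < j\<close> by (simp add: algebra_simps)
      ultimately show False
        by simp
    qed
    then show ?thesis
      by blast
  qed
  then have disj: "disjoint_family ?A"
    unfolding disjoint_family_on_def linorder_neq_iff by (intro ballI impI) (erule disjE, fast, subst Int_commute, fast)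
  have eq: "measure \<mu> (?A i) = measure \<mu> {x \<in> XL. L x}" for i
    using emeasure_site[OF sets_Collect[OF L], of 0 "s * int i"] by (simp add: measure_def)
  have "(\<lambda>i. measure \<mu> (?A i)) sums measure \<mu> (\<Union>i. ?A i)"
    by (rule finite_measure_UNION[OF sets disj])
  then have "summable (\<lambda>i::nat. measure \<mu> {x \<in> XL. L x})"
    unfolding eq by (rule sums_summable)
  then have "measure \<mu> {x \<in> XL. L x} = 0"
    by (simp add: summable_const_iff)
  then have "AE x in \<mu>. \<not> L x"
    using AE_not_iff_null[OF L] by (simp add: emeasure_eq_measure)
  from AE_site[OF this] show ?thesis
  proof eventually_elim
    case (elim x)
    show ?case
    proof (intro allI impI, rule ccontr)
      fix k m assume k: "Q (site x 0 (s * k))" and m: "\<not> (\<exists>j>m. Q (site x 0 (s * j)))"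
      let ?J = "{j \<in> {k..m}. Q (site x 0 (s * j))}"
      have fin: "finite ?J"
        by (rule finite_subset[of _ "{k..m}"]) auto
      have "\<not> m < k"
        using k m by blast
      then have "k \<in> ?J"
        using k by simp
      then have "?J \<noteq> {}"
        by blast
      then have max: "Max ?J \<in> ?J" "\<And>j. j \<in> ?J \<Longrightarrow> j \<le> Max ?J"
        using Max_in[OF fin] Max_ge[OF fin] by blast+
      have "\<not> Q (site (site x 0 (s * Max ?J)) 0 (s * i))" if "i > 0" for i
      proof
        assume "Q (site (site x 0 (s * Max ?J)) 0 (s * i))"
        then have Q: "Q (site x 0 (s * (Max ?J + i)))"
          by (simp add: distrib_left)
        then have "Max ?J + i \<le> m"
          using m by force
        then have "Max ?J + i \<in> ?J"
          using Q max(1) that by simp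
        then show False
          using max(2) that by force
      qed
      then have "L (site x 0 (s * Max ?J))"
        using max(1) unfolding L_def by blast
      then show False
        using elim by blast
    qed
  qed
qed

lemma AE_unbounded:
  assumes Q: "Measurable.pred borel Q"
  shows "AE x in \<mu>. \<forall>n k. Q (site x n k) \<longrightarrow> (\<forall>m. \<exists>j>m. Q (site x n j)) \<and> (\<forall>m. \<exists>j<m. Q (site x n j))"
proof -
  have "AE x in \<mu>. \<forall>m. \<forall>k. Q (site x m k) \<longrightarrow> (\<forall>i. \<exists>j>i. Q (site x m j))"
    using AE_site[OF AE_recurrent[OF Q, of 1]]
    by eventually_elim (metis (no_types, lifting) add_0_right add_0_left mult_1 site_site)
  moreover have "AE x in \<mu>. \<forall>m. \<forall>k. Q (site x m k) \<longrightarrow> (\<forall>i. \<exists>j<i. Q (site x m j))"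
    using AE_site[OF AE_recurrent[OF Q, of "- 1"]]
  proof eventually_elim
    case (elim x)
    show ?case
    proof (intro allI impI)
      fix m k i assume "Q (site x m k)"
      then have "Q (site (site x m 0) 0 (- 1 * - k))"
        by simp
      then obtain j where "j > - i" "Q (site (site x m 0) 0 (- 1 * j))"
        using elim by blast
      then show "\<exists>j<i. Q (site x m j)"
        by (intro exI[of _ "- j"]) simp
    qed
  qed
  ultimately show ?thesis
    by eventually_elim blast
qed

text \<open>
  Conservation of mass. The relation \<open>R i x\<close> says that the map sends \<open>x\<close> to
  \<open>site x (a i) (b i)\<close>. The map preserves the measure on each of its countably many pieces and the
  images of the pieces are disjoint, so the image has the same finite measure as the set \<open>Q\<close> that
  contains it. Images are described by pulling back along \<open>site y (- a i) (- b i)\<close>, which keeps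
  all sets Borel by construction.
\<close>

lemma AE_injective_onto:
  fixes R :: "'i::countable \<Rightarrow> config \<Rightarrow> bool"
  assumes Q: "Measurable.pred borel Q" and R: "\<And>i. Measurable.pred borel (R i)"
    and total: "AE x in \<mu>. Q x \<longrightarrow> (\<exists>i. R i x)"
    and functional: "\<And>i j x. x \<in> XL \<Longrightarrow> R i x \<Longrightarrow> R j x \<Longrightarrow> i = j"
    and range: "\<And>i y. y \<in> XL \<Longrightarrow> R i (site y (- a i) (- b i)) \<Longrightarrow> Q y"
    and injective: "\<And>i j y. y \<in> XL \<Longrightarrow> R i (site y (- a i) (- b i)) \<Longrightarrow> R j (site y (- a j) (- b j)) \<Longrightarrow> i = j"
  shows "AE y in \<mu>. Q y \<longrightarrow> (\<exists>i. R i (site y (- a i) (- b i)))"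
proof -
  let ?A = "\<lambda>i. {x \<in> XL. R i x}"
  let ?B = "\<lambda>i. {y \<in> XL. R i (site y (- a i) (- b i))}"
  let ?Q = "{x \<in> XL. Q x}"
  have sets: "?A i \<in> sets \<mu>" "?B i \<in> sets \<mu>" "?Q \<in> sets \<mu>" for i
    by (intro sets_Collect pred_site R Q)+
  have UN: "(\<Union>i. ?A i) \<in> sets \<mu>" "(\<Union>i. ?B i) \<in> sets \<mu>"
    using sets by (auto intro!: sets.countable_UN'')
  have "emeasure \<mu> ?Q \<le> emeasure \<mu> (\<Union>i. ?A i)"
    using total by (intro emeasure_mono_AE UN(1)) (auto elim!: eventually_mono)
  also have "\<dots> = (\<integral>\<^sup>+i. emeasure \<mu> (?A i) \<partial>count_space UNIV)"
    using sets functional by (intro emeasure_UN_countable) (auto simp: disjoint_family_on_def)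
  also have "\<dots> = (\<integral>\<^sup>+i. emeasure \<mu> (?B i) \<partial>count_space UNIV)"
  proof (rule nn_integral_cong)
    fix i
    have "?B i = {y \<in> XL. site y (- a i) (- b i) \<in> ?A i}"
      by (auto simp: site_in_XL)
    then show "emeasure \<mu> (?A i) = emeasure \<mu> (?B i)"
      using emeasure_site[OF sets(1)[of i], of "- a i" "- b i"] by simp
  qed
  also have "\<dots> = emeasure \<mu> (\<Union>i. ?B i)"
    using sets injective by (intro emeasure_UN_countable[symmetric]) (auto simp: disjoint_family_on_def)
  finally have "emeasure \<mu> ?Q \<le> emeasure \<mu> (\<Union>i. ?B i)" .
  moreover have "(\<Union>i. ?B i) \<subseteq> ?Q"
    using range by auto
  ultimately have "emeasure \<mu> (?Q - (\<Union>i. ?B i)) = 0"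
    using sets(3) UN(2) by (subst emeasure_Diff) (auto simp: emeasure_eq_measure ennreal_minus ennreal_eq_0_iff)
  then have "?Q - (\<Union>i. ?B i) \<in> null_sets \<mu>"
    using sets(3) UN(2) by (intro null_setsI) auto
  from AE_not_in[OF this] AE_in_XL show ?thesis
    by eventually_elim auto
qed

text \<open>
  The map sends a rightmost one to the rightmost one of its component on the next antidiagonal. It
  is defined almost everywhere because a later one, needed to bound the component, exists by
  recurrence. Two rightmost ones with the same image coalesce, hence are equal.
\<close>

lemma AE_rightmost_antecedent:
  "AE x in \<mu>. \<forall>n e. rightmost x n e \<longrightarrow> (\<exists>d. rightmost x (n - 1) d \<and> coalesce x n (step x (n - 1) d) e)"
proof -
  define R where "R i x \<longleftrightarrow> rightmost x 0 0 \<and> rightmost x 1 i \<and> coalesce x 1 (step x 0 0) i" for i x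
  have one: "AE x in \<mu>. \<forall>k. one x 0 k \<longrightarrow> (\<exists>j>k. one x 0 j)"
    using AE_unbounded[OF pred_one[of 0 0]]
  proof eventually_elim
    case (elim x)
    show ?case
      using elim[rule_format, of 0] by auto
  qed
  have "AE y in \<mu>. rightmost y 0 0 \<longrightarrow> (\<exists>i. R i (site y (- 1) (- i)))"
  proof (rule AE_injective_onto)
    show "AE x in \<mu>. rightmost x 0 0 \<longrightarrow> (\<exists>i. R i x)"
      using one AE_in_XL
    proof eventually_elim
      case (elim x)
      show ?case
      proof
        assume r: "rightmost x 0 0"
        then obtain f where "f > 0" "one x 0 f"
          using elim(1) by (auto simp: rightmost_def)
        then show "\<exists>i. R i x"
          using rightmost_next[OF elim(2) r] r by (simp add: R_def)
      qed
    qed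
    show "i = j" if "R i x" "R j x" for i j x
      using that rightmost_unique[of x 1 i j] coalesce_common[of x 1 "step x 0 0" i j] by (simp add: R_def)
    show "rightmost y 0 0" if "R i (site y (- 1) (- i))" for i y
      using that by (simp add: R_def)
    show "i = j" if "R i (site y (- 1) (- i))" "R j (site y (- 1) (- j))" for i j y
    proof -
      have r: "rightmost y (- 1) (- i)" "rightmost y (- 1) (- j)"
        "coalesce y 0 (step y (- 1) (- i)) 0" "coalesce y 0 (step y (- 1) (- j)) 0"
        using that by (simp_all add: R_def)
      then have "coalesce y (- 1 + 1) (step y (- 1) (- i)) (step y (- 1) (- j))"
        using coalesce_common'[of y 0 "step y (- 1) (- i)" 0 "step y (- 1) (- j)"] by simp
      then have "- i = - j"
        unfolding coalesce_step by (rule rightmost_unique[OF r(1,2)])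
      then show ?thesis
        by simp
    qed
    show "Measurable.pred borel (R i)" for i
      unfolding R_def[abs_def] by measurable
  qed measurable
  from AE_site[OF this] show ?thesis
  proof eventually_elim
    case (elim x)
    show ?case
    proof (intro allI impI)
      fix n e assume "rightmost x n e"
      then obtain i where "R i (site (site x n e) (- 1) (- i))"
        using elim[rule_format, of n e] by auto
      then show "\<exists>d. rightmost x (n - 1) d \<and> coalesce x n (step x (n - 1) d) e"
        by (intro exI[of _ "e - i"]) (simp add: R_def)
    qed
  qed
qed

text \<open>
  The map sends an ancient one to an ancient antecedent, preferring the left one; \<open>T\<close> tells whether
  the left one was chosen. It is injective because \<open>\<sigma>\<close> is a function. A right ancient antecedent
  with an ancient left sibling would not be in the image, so almost surely there are no such siblings.
\<close>

lemma AE_ancient_step_inj: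
  "AE x in \<mu>. \<forall>n i j. ancient x n i \<longrightarrow> ancient x n j \<longrightarrow> step x n i = step x n j \<longrightarrow> i = j"
proof -
  define R where "R T x \<longleftrightarrow> ancient x 0 0 \<and>
    (if T then ancient x (- 1) (- 1) else ancient x (- 1) 0 \<and> \<not> ancient x (- 1) (- 1))" for T x
  define b where "b T = (if T then - 1 else 0 :: int)" for T
  have "AE y in \<mu>. ancient y 0 0 \<longrightarrow> (\<exists>T. R T (site y (- (- 1)) (- b T)))"
  proof (rule AE_injective_onto)
    show "AE x in \<mu>. ancient x 0 0 \<longrightarrow> (\<exists>T. R T x)"
      using AE_in_XL
    proof eventually_elim
      case (elim x)
      show ?case
      proof
        assume "ancient x 0 0"
        moreover obtain j where j: "ancient x (- 1) j" "step x (- 1) j = 0"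
          using ancient_antecedent[OF elim \<open>ancient x 0 0\<close>] by auto
        then have "j = - 1 \<or> j = 0"
          by (auto simp: step_def split: if_splits)
        ultimately show "\<exists>T. R T x"
          using j(1) unfolding R_def by (cases "ancient x (- 1) (- 1)") auto
      qed
    qed
    show "S = T" if "R S x" "R T x" for S T x
      using that by (auto simp: R_def split: if_splits)
    show "ancient y 0 0" if "R T (site y (- (- 1)) (- b T))" for T y
      using that by (auto simp: R_def b_def split: if_splits)
    show "S = T" if "y \<in> XL" "R S (site y (- (- 1)) (- b S))" "R T (site y (- (- 1)) (- b T))" for S T y
    proof (rule ccontr)
      assume "S \<noteq> T"
      then have "ancient y 1 1" "ancient y 1 0" "ancient y 0 0"
        using that(2,3) by (auto simp: R_def b_def split: if_splits)
      then show False
        using one_rule[OF that(1), of 0 0] ancient_one by force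
    qed
    show "Measurable.pred borel (R T)" for T
      unfolding R_def[abs_def] by (cases T) simp_all
  qed measurable
  then have "AE y in \<mu>. ancient y 0 0 \<longrightarrow> ancient y 1 1 \<or> \<not> ancient y 0 (- 1)"
    by eventually_elim (auto simp: R_def b_def split: if_splits)
  \<comment> \<open>Coalescing neighbours \<open>i\<close>, \<open>i + 1\<close> both move to \<open>i + 1\<close>, and \<open>i + 1\<close> is the sibling outside the image.\<close>
  from AE_site[OF this] show ?thesis
  proof eventually_elim
    case (elim x)
    have less: "False" if "ancient x n i" "ancient x n j" "step x n i = step x n j" "i < j" for n i j
    proof -
      have "j = i + 1" "step x n j = j"
        using that(3,4) by (auto simp: step_def split: if_splits)
      then have "\<not> one x (n + 1) (j + 1)"
        by (auto simp: step_def)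
      then have "\<not> ancient x (n + 1) (j + 1)"
        using ancient_one by blast
      then show False
        using elim[rule_format, of n j] that(1,2) \<open>j = i + 1\<close> by simp
    qed
    then show ?case
      by (metis linorder_neqE)
  qed
qed

end

section \<open>Components of free orbits\<close>

lemma shift_antidiagonal: "shiftZ2 k (- k) x = site x 0 k"
  by (simp add: site_def)

lemma ancient_coalesce_eq:
  assumes "x \<in> XL"
    and inj: "\<And>n i j. ancient x n i \<Longrightarrow> ancient x n j \<Longrightarrow> step x n i = step x n j \<Longrightarrow> i = j"
    and "ancient x n i" "ancient x n j" "coalesce x n i j"
  shows "i = j"
proof -
  have "i = j" if "ancient x n i" "ancient x n j" "walk x n i p = walk x n j p" for n p
    using that
  proof (induction p arbitrary: i j n)
    case (Suc p)
    then have "step x n i = step x n j"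
      using ancient_step[OF assms(1)] unfolding walk_1 by blast
    then show ?case
      using inj Suc.prems by blast
  qed simp
  then show ?thesis
    using assms(3-5) unfolding coalesce_def by blast
qed

text \<open>
  The two lemmas below translate membership in a component to sites; only the second one needs
  that different sites are different points.
\<close>

lemma site_in_component:
  assumes "x \<in> XL" "one x n k" "one x m j" "n + int p = m + int q" "walk x n k p = walk x m j q"
  shows "site x m j \<in> sigma_component (site x n k)"
proof -
  have "site x m j = site (site x n k) (m - n) (j - k)"
    by simp
  then have "site x m j \<in> orbit (site x n k)"
    unfolding orbit_eq by blast
  moreover have "(sigmaL ^^ p) (site x n k) = (sigmaL ^^ q) (site x m j)"
    using assms by (simp add: sigmaL_pow_site)
  ultimately show ?thesis
    using assms(1,3) by (auto simp: sigma_component_def site_in_YL)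
qed

lemma component_site:
  assumes "x \<in> XL" "free_orbit x" "one x n k" "one x m j" "site x m j \<in> sigma_component (site x n k)"
  shows "\<exists>p q. n + int p = m + int q \<and> walk x n k p = walk x m j q"
proof -
  obtain p q where "site x (n + int p) (walk x n k p) = site x (m + int q) (walk x m j q)"
    using assms by (auto simp: sigma_component_def sigmaL_pow_site)
  then show ?thesis
    using site_inj[OF assms(2)] by blast
qed

lemma same_component_coalesce:
  assumes "x \<in> XL" "free_orbit x" "one x n k" "one x m i" "one x m j"
    and "site x m i \<in> sigma_component (site x n k)" "site x m j \<in> sigma_component (site x n k)"
  shows "coalesce x m i j"
proof -
  obtain p q where p: "n + int p = m + int q" "walk x n k p = walk x m i q"
    using component_site[OF assms(1-3,4,6)] by blast
  obtain p' q' where p': "n + int p' = m + int q'" "walk x n k p' = walk x m j q'"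
    using component_site[OF assms(1-3,5,7)] by blast
  have "walk x n k (p + p') = walk x m i (q + p')" "walk x n k (p' + p) = walk x m j (q' + p)"
    unfolding walk_add using p p' by simp_all
  moreover have "q + p' = q' + p"
    using p(1) p'(1) by simp
  ultimately have "walk x m i (q + p') = walk x m j (q + p')"
    by (simp add: add.commute)
  then show ?thesis
    unfolding coalesce_def by blast
qed

text \<open>
  An ancient one can be carried to antidiagonal \<open>0\<close> inside its component: forwards along its path,
  backwards along ancient antecedents.
\<close>

lemma components_meet_ancient:
  assumes "x \<in> XL" "one x n k" "ancient x n j" "coalesce x n k j"
  shows "\<exists>i. ancient x 0 i \<and> site x 0 i \<in> sigma_component (site x n k)"
proof -
  obtain p where p: "walk x n k p = walk x n j p"
    using assms(4) unfolding coalesce_def by blast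
  show ?thesis
  proof (cases "n \<ge> 0")
    case True
    then obtain i where i: "ancient x 0 i" "walk x 0 i (nat n) = j"
      using ancient_antecedents[OF assms(1,3), of "nat n"] by auto
    then have "walk x n k p = walk x 0 i (nat n + p)"
      unfolding walk_add using p True by simp
    then show ?thesis
      using i(1) True site_in_component[OF assms(1,2) ancient_one[OF i(1)], of p "nat n + p"] by auto
  next
    case False
    let ?i = "walk x n j (nat (- n))"
    have i: "ancient x 0 ?i"
      using ancient_walk[OF assms(1,3), of "nat (- n)"] False by simp
    have "walk x n j (nat (- n) + p) = walk x 0 ?i p"
      unfolding walk_add using False by simp
    moreover have "walk x n k (nat (- n) + p) = walk x n j (nat (- n) + p)"
      by (rule walk_eq_later[OF p]) simp
    ultimately show ?thesis
      using i False site_in_component[OF assms(1,2) ancient_one[OF i], of "nat (- n) + p" p] by auto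
  qed
qed

text \<open>
  Rightmost ones on both sides of \<open>k\<close> separate its component from infinity on antidiagonal \<open>n\<close>,
  because components are intervals.
\<close>

lemma one_coalesces_ancient:
  assumes "x \<in> XL"
    and antecedent: "\<And>n e. rightmost x n e \<Longrightarrow> \<exists>d. rightmost x (n - 1) d \<and> coalesce x n (step x (n - 1) d) e"
    and above: "\<And>m. \<exists>r>m. rightmost x n r" and below: "\<And>m. \<exists>l<m. rightmost x n l"
    and "one x n k"
  shows "\<exists>j. ancient x n j \<and> coalesce x n k j"
proof -
  obtain r where r: "r > k" "rightmost x n r"
    using above by blast
  have "\<not> coalesce x n k j" if j: "j > r" "one x n j" for j
  proof
    assume c: "coalesce x n k j"
    then have "coalesce x n k r"
      using coalesce_between[OF c] r(1) j(1) by simp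
    then have "coalesce x n r j"
      using c by (rule coalesce_common)
    then show False
      using r(2) j unfolding rightmost_def by blast
  qed
  then obtain e where e: "rightmost x n e" "coalesce x n k e"
    using rightmost_exists[OF assms(5)] by blast
  obtain l where "l < e" "rightmost x n l"
    using below by blast
  then obtain j where "ancient x n j" "coalesce x n j e"
    using bounded_component_meets_ancient[OF assms(1) antecedent _ _ e(1)] by blast
  then show ?thesis
    using coalesce_common'[OF e(2)] by blast
qed

text \<open>
  Rightmost ones propagate backwards by conservation of mass, and forwards by \<open>rightmost_next\<close>, where
  the next rightmost one bounds the component.
\<close>

lemma rightmost_on_every_antidiagonal:
  assumes "x \<in> XL" "rightmost x n e"
    and antecedent: "\<And>n e. rightmost x n e \<Longrightarrow> \<exists>d. rightmost x (n - 1) d \<and> coalesce x n (step x (n - 1) d) e"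
    and above: "\<And>n e. rightmost x n e \<Longrightarrow> \<exists>f>e. rightmost x n f"
  shows "\<exists>e. rightmost x m e"
proof (induction m rule: int_induct[where k = n])
  case base
  show ?case
    using assms(2) by blast
next
  case (step1 m)
  then obtain e where e: "rightmost x m e"
    by blast
  then obtain f where "f > e" "rightmost x m f"
    using above by blast
  then show ?case
    using rightmost_next[OF assms(1) e] unfolding rightmost_def by blast
next
  case (step2 m)
  then show ?case
    using antecedent by blast
qed

section \<open>Ergodic measures\<close>

locale ergodic_prob = invariant_prob +
  assumes atomless: "atomless_measure \<mu>"
    and ergodic: "ergodic_measure \<mu>"
begin

lemma AE_ergodic:
  assumes Q: "Measurable.pred borel Q" and "\<not> (AE x in \<mu>. \<not> Q x)"
  shows "AE x in \<mu>. \<exists>n k. Q (site x n k)"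
proof -
  let ?A = "{x \<in> XL. \<exists>n k. Q (site x n k)}"
  note [measurable] = pred_site[OF Q]
  have A: "?A \<in> sets \<mu>"
    by (rule sets_Collect) measurable
  have sub: "shiftZ2 a b ` ?A \<subseteq> ?A" for a b
  proof clarify
    fix x n k assume "x \<in> XL" "Q (site x n k)"
    then have "Q (site (shiftZ2 a b x) (n - (a + b)) (k - a))"
      by (simp add: shift_eq_site)
    then show "shiftZ2 a b x \<in> XL \<and> (\<exists>n k. Q (site (shiftZ2 a b x) n k))"
      using shift_in_XL[OF \<open>x \<in> XL\<close>] by blast
  qed
  have "?A \<subseteq> shiftZ2 a b ` ?A" for a b
  proof
    fix x assume "x \<in> ?A"
    then have "shiftZ2 (- a) (- b) x \<in> ?A"
      using sub by blast
    moreover have "x = shiftZ2 a b (shiftZ2 (- a) (- b) x)"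
      by (simp add: shift_add shift_zero)
    ultimately show "x \<in> shiftZ2 a b ` ?A"
      by blast
  qed
  then have "Z2_invariant ?A"
    using sub unfolding Z2_invariant_def by blast
  then have "prob ?A = 0 \<or> prob ?A = 1"
    using ergodic A unfolding ergodic_measure_def by blast
  moreover have "prob ?A \<noteq> 0"
  proof
    assume "prob ?A = 0"
    then have "AE x in \<mu>. x \<notin> ?A"
      using prob_eq_0[OF A] by simp
    then have "AE x in \<mu>. \<not> Q x"
      using AE_in_XL
    proof eventually_elim
      case (elim x)
      then have "\<not> Q (site x 0 0)"
        by blast
      then show ?case
        by simp
    qed
    then show False
      using assms(2) by blast
  qed
  ultimately have "AE x in \<mu>. x \<in> ?A"
    using prob_eq_1[OF A] by simp
  then show ?thesis
    by eventually_elim simp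
qed

lemma AE_neq:
  assumes "y \<in> XL"
  shows "AE x in \<mu>. x \<noteq> y"
proof -
  have "closed {x :: config. \<forall>i. x i = y i}"
    by (intro closed_Collect_all closed_Collect_eq continuous_on_product_coordinates continuous_on_const)
  moreover have "{x. \<forall>i. x i = y i} = {y}"
    by auto
  ultimately have "closed {y}"
    by simp
  then have s: "{y} \<in> sets \<mu>"
    using assms by (auto simp: sets_eq sets_borel_XL)
  have "emeasure \<mu> {y} = 0"
  proof (rule ccontr)
    assume "emeasure \<mu> {y} \<noteq> 0"
    then have "emeasure \<mu> {y} > 0"
      by (simp add: zero_less_iff_neq_zero)
    then obtain B where B: "B \<subseteq> {y}" "0 < emeasure \<mu> B" "emeasure \<mu> B < emeasure \<mu> {y}"
      using atomless s unfolding atomless_measure_def by blast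
    from B(1) have "B = {} \<or> B = {y}"
      by blast
    then show False
      using B(2,3) by auto
  qed
  then have "AE x in \<mu>. x \<notin> {y}"
    using s by (intro AE_not_in null_setsI)
  then show ?thesis
    by simp
qed

text \<open>There are countably many periods, each with finitely many periodic points, and points are null.\<close>

lemma AE_free_orbit: "AE x in \<mu>. free_orbit x"
proof -
  have "AE x in \<mu>. site x n k = x \<longrightarrow> n = 0 \<and> k = 0" for n k
  proof (cases "n = 0 \<and> k = 0")
    case False
    let ?P = "{x \<in> XL. \<forall>i j. x (i + k, j + (n - k)) = x (i, j)}"
    have "finite ?P"
      using False by (intro finite_periodic) auto
    then have "AE x in \<mu>. \<forall>y\<in>?P. x \<noteq> y"
      by (rule AE_finite_allI) (simp add: AE_neq)
    then show ?thesis
      using AE_in_XL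
    proof eventually_elim
      case (elim x)
      have "x \<in> ?P" if "site x n k = x"
      proof -
        have "shiftZ2 k (n - k) x (i, j) = x (i, j)" for i j
          using that by (simp add: site_def)
        then show ?thesis
          using elim(2) by (simp add: shiftZ2_def)
      qed
      then show ?case
        using elim(1) by blast
    qed
  qed simp
  then show ?thesis
    by (simp add: free_orbit_def AE_all_countable)
qed

lemma AE_ZL_iff_ancient: "AE x in \<mu>. \<forall>n k. site x n k \<in> ZL \<longleftrightarrow> ancient x n k"
proof -
  have "AE x in \<mu>. x \<in> ZL \<longleftrightarrow> ancient x 0 0"
    using AE_free_orbit AE_in_XL by eventually_elim (rule ZL_iff_ancient)
  from AE_site[OF this] show ?thesis
    by eventually_elim simp
qed

lemma ZL_null_iff: "prob ZL = 0 \<longleftrightarrow> (AE x in \<mu>. \<forall>n k. \<not> ancient x n k)"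
proof -
  have "prob ZL = 0 \<longleftrightarrow> (AE x in \<mu>. x \<notin> ZL)"
    using ZL_borel by (intro prob_eq_0) (simp add: sets_eq)
  also have "\<dots> \<longleftrightarrow> (AE x in \<mu>. \<forall>n k. site x n k \<notin> ZL)"
  proof
    assume "AE x in \<mu>. \<forall>n k. site x n k \<notin> ZL"
    then show "AE x in \<mu>. x \<notin> ZL"
      by eventually_elim (metis site_0)
  qed (rule AE_site)
  also have "\<dots> \<longleftrightarrow> (AE x in \<mu>. \<forall>n k. \<not> ancient x n k)"
  proof
    assume "AE x in \<mu>. \<forall>n k. site x n k \<notin> ZL"
    then show "AE x in \<mu>. \<forall>n k. \<not> ancient x n k"
      using AE_ZL_iff_ancient by eventually_elim blast
  next
    assume "AE x in \<mu>. \<forall>n k. \<not> ancient x n k"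
    then show "AE x in \<mu>. \<forall>n k. site x n k \<notin> ZL"
      using AE_ZL_iff_ancient by eventually_elim blast
  qed
  finally show ?thesis .
qed

lemma AE_ancient_unbounded:
  "AE x in \<mu>. \<forall>n k. ancient x n k \<longrightarrow> (\<forall>m. \<exists>j>m. ancient x n j) \<and> (\<forall>m. \<exists>j<m. ancient x n j)"
  using AE_unbounded[OF pred_ancient[of 0 0]] by simp

lemma AE_rightmost_unbounded:
  "AE x in \<mu>. \<forall>n k. rightmost x n k \<longrightarrow> (\<forall>m. \<exists>j>m. rightmost x n j) \<and> (\<forall>m. \<exists>j<m. rightmost x n j)"
  using AE_unbounded[OF pred_rightmost[of 0 0]] by simp

text \<open>
  Without rightmost ones any two ones of an antidiagonal coalesce. An ancient one would recur on its
  antidiagonal, giving two ancient ones in a single component.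
\<close>

lemma property_i_if_no_rightmost:
  assumes "AE x in \<mu>. \<not> rightmost x 0 0"
  shows "property_i \<mu>"
proof -
  have none: "AE x in \<mu>. \<forall>n k. \<not> rightmost x n k"
    using AE_site[OF assms] by simp
  have "AE x in \<mu>. \<forall>n k. \<not> ancient x n k"
    using none AE_ancient_unbounded AE_ancient_step_inj AE_in_XL
  proof eventually_elim
    case (elim x)
    show ?case
    proof (intro allI notI)
      fix n k assume k: "ancient x n k"
      then obtain j where j: "j > k" "ancient x n j"
        using elim(2) by blast
      have "coalesce x n k j"
        using all_coalesce elim(1) ancient_one[OF k] ancient_one[OF j(2)] by blast
      then have "k = j"
        using ancient_coalesce_eq[OF elim(4) _ k j(2)] elim(3) by blast
      then show False
        using j(1) by simp
    qed
  qed
  then have "prob ZL = 0"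
    by (simp add: ZL_null_iff)
  moreover obtain B where B: "B \<in> sets \<mu>" "Z2_invariant B" "prob B = 1"
    "\<And>x. x \<in> B \<Longrightarrow> x \<in> XL \<and> (\<forall>n k. \<not> rightmost x n k)"
    using invariant_full_set[OF none] by blast
  moreover have "orbit x \<inter> YL \<subseteq> sigma_component x" if x: "x \<in> YL \<inter> B" for x
  proof
    fix y assume y: "y \<in> orbit x \<inter> YL"
    have XL: "x \<in> XL" and x1: "one x 0 0"
      using x B(4) site_in_YL[of x 0 0] by auto
    obtain n k where nk: "y = site x n k" "one x n k"
      using y site_in_YL[OF XL] unfolding orbit_eq by auto
    let ?i = "walk x 0 0 (nat n)" and ?j = "walk x n k (nat (- n))"
    have e: "0 + int (nat n) = n + int (nat (- n))"
      by simp
    have "one x (0 + int (nat n)) ?i" "one x (0 + int (nat n)) ?j"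
      using one_walk[OF XL x1] one_walk[OF XL nk(2)] unfolding e by (metis e)+
    then have "coalesce x (0 + int (nat n)) ?i ?j"
      using all_coalesce B(4) x by blast
    then obtain p where "walk x (0 + int (nat n)) ?i p = walk x (0 + int (nat n)) ?j p"
      unfolding coalesce_def by blast
    then have "walk x 0 0 (nat n + p) = walk x n k (nat (- n) + p)"
      unfolding walk_add using e by metis
    moreover have "0 + int (nat n + p) = n + int (nat (- n) + p)"
      by simp
    ultimately have "site x n k \<in> sigma_component (site x 0 0)"
      using site_in_component[OF XL x1 nk(2)] by blast
    then show "y \<in> sigma_component x"
      using nk(1) by simp
  qed
  ultimately show ?thesis
    unfolding property_i_def by blast
qed

text \<open>
  Every component contains an ancient one because rightmost ones are unbounded on both sides. On
  antidiagonal \<open>0\<close> this ancient one is unique in its component, so recurrence of ancient ones gives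
  infinitely many components.
\<close>

lemma property_ii_if_rightmost:
  assumes "\<not> (AE x in \<mu>. \<not> rightmost x 0 0)"
  shows "property_ii \<mu>"
proof -
  have ex: "AE x in \<mu>. \<exists>n k. rightmost x n k"
    using AE_ergodic[OF pred_rightmost assms] by simp
  have meets: "AE x in \<mu>. (\<forall>n k. one x n k \<longrightarrow> (\<exists>j. ancient x n j \<and> coalesce x n k j)) \<and> (\<exists>n k. one x n k)"
    using ex AE_rightmost_unbounded AE_rightmost_antecedent AE_in_XL
  proof eventually_elim
    case (elim x)
    obtain n e where e: "rightmost x n e"
      using elim(1) by blast
    have above: "\<exists>r>i. rightmost x m r" and below: "\<exists>l<i. rightmost x m l"
      if "rightmost x m f" for m f i
      using elim(2) that by blast+
    have antecedent: "\<exists>d. rightmost x (m - 1) d \<and> coalesce x m (step x (m - 1) d) f"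
      if "rightmost x m f" for m f
      using elim(3) that by blast
    have all: "\<exists>f. rightmost x m f" for m
      by (rule rightmost_on_every_antidiagonal[OF elim(4) e antecedent above])
    have "\<exists>j. ancient x m j \<and> coalesce x m k j" if "one x m k" for m k
    proof -
      obtain f where f: "rightmost x m f"
        using all by blast
      show ?thesis
        by (rule one_coalesces_ancient[OF elim(4) antecedent above[OF f] below[OF f] that])
    qed
    then have "\<forall>m k. one x m k \<longrightarrow> (\<exists>j. ancient x m j \<and> coalesce x m k j)"
      by (intro allI impI)
    moreover have "one x n e"
      using e by (simp add: rightmost_def)
    then have "\<exists>n k. one x n k"
      by (intro exI)
    ultimately show ?case
      by (rule conjI)
  qed
  define P where "P x \<longleftrightarrow> free_orbit x \<and>
    (\<forall>n k. site x n k \<in> ZL \<longleftrightarrow> ancient x n k) \<and>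
    (\<forall>n i j. ancient x n i \<longrightarrow> ancient x n j \<longrightarrow> step x n i = step x n j \<longrightarrow> i = j) \<and>
    (\<forall>n k. ancient x n k \<longrightarrow> (\<forall>m. \<exists>j>m. ancient x n j) \<and> (\<forall>m. \<exists>j<m. ancient x n j)) \<and>
    (\<forall>n k. one x n k \<longrightarrow> (\<exists>j. ancient x n j \<and> coalesce x n k j))" for x
  have AE_P: "AE x in \<mu>. P x"
    using AE_free_orbit AE_ZL_iff_ancient AE_ancient_step_inj AE_ancient_unbounded meets
  proof eventually_elim
    case (elim x)
    show ?case
      unfolding P_def by (intro conjI elim(1-4) conjunct1[OF elim(5)])
  qed
  then obtain B where B: "B \<in> sets \<mu>" "Z2_invariant B" "prob B = 1"
    and BP: "\<And>x. x \<in> B \<Longrightarrow> x \<in> XL \<and> P x"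
    using invariant_full_set[OF AE_P] by blast
  have "prob ZL \<noteq> 0"
  proof
    assume "prob ZL = 0"
    then have "AE x in \<mu>. \<forall>n k. \<not> ancient x n k"
      by (simp add: ZL_null_iff)
    then have "AE x in \<mu>. False"
      using meets by eventually_elim blast
    then show False
      by simp
  qed
  then have pos: "prob ZL > 0"
    by (simp add: zero_less_measure_iff)
  have a: "sigma_component x \<inter> ZL \<noteq> {}" if x: "x \<in> YL \<inter> B" for x
  proof -
    have XL: "x \<in> XL" and x1: "one x 0 0" and "P x"
      using x BP site_in_YL[of x 0 0] by auto
    then obtain j where "ancient x 0 j" "coalesce x 0 0 j"
      unfolding P_def by blast
    then obtain i where i: "ancient x 0 i" "site x 0 i \<in> sigma_component (site x 0 0)"
      using components_meet_ancient[OF XL x1] by blast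
    then have "site x 0 i \<in> ZL"
      using \<open>P x\<close> unfolding P_def by blast
    then show ?thesis
      using i(2) by auto
  qed
  have b: "\<exists>!y. y \<in> {y \<in> YL. sigmaL y = x} \<inter> ZL" if x: "x \<in> ZL \<inter> B" for x
  proof -
    have XL: "x \<in> XL" and "P x"
      using x BP by auto
    then have Z: "site x n k \<in> ZL \<longleftrightarrow> ancient x n k" for n k
      unfolding P_def by blast
    have "ancient x 0 0"
      using x Z[of 0 0] by simp
    then obtain j where j: "ancient x (- 1) j" "step x (- 1) j = 0"
      using ancient_antecedent[OF XL] by fastforce
    have fibre: "{y \<in> YL. sigmaL y = x} = site x (- 1) ` {j. one x (- 1) j \<and> step x (- 1) j = 0}"
      using sigma_fibre[OF XL, of 1] by simp
    show ?thesis
    proof (rule ex1I[of _ "site x (- 1) j"])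
      show "site x (- 1) j \<in> {y \<in> YL. sigmaL y = x} \<inter> ZL"
        unfolding fibre using j ancient_one[OF j(1)] Z by blast
      fix y assume "y \<in> {y \<in> YL. sigmaL y = x} \<inter> ZL"
      then obtain i where i: "y = site x (- 1) i" "step x (- 1) i = 0" "ancient x (- 1) i"
        unfolding fibre using Z by blast
      then have "step x (- 1) i = step x (- 1) j"
        using j(2) by simp
      then have "i = j"
        using \<open>P x\<close> i(3) j(1) unfolding P_def by blast
      then show "y = site x (- 1) j"
        using i(1) by simp
    qed
  qed
  have c: "infinite (orbit_components x) \<and>
      (\<forall>C \<in> orbit_components x. \<exists>!k. shiftZ2 k (- k) x \<in> ZL \<inter> C) \<and>
      \<not> bdd_above {k. shiftZ2 k (- k) x \<in> ZL} \<and> \<not> bdd_below {k. shiftZ2 k (- k) x \<in> ZL}"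
    if x: "x \<in> YL \<inter> B" for x
  proof -
    have XL: "x \<in> XL" and x1: "one x 0 0" and P: "P x"
      using x BP site_in_YL[of x 0 0] by auto
    then have Z: "site x n k \<in> ZL \<longleftrightarrow> ancient x n k" for n k
      unfolding P_def by blast
    have free: "free_orbit x"
      using P unfolding P_def by blast
    have step_inj: "i = j" if "ancient x n i" "ancient x n j" "step x n i = step x n j" for n i j
      using P that unfolding P_def by blast
    have inj: "i = j" if "ancient x n i" "ancient x n j" "coalesce x n i j" for n i j
      using XL step_inj that by (rule ancient_coalesce_eq)
    obtain k0 where "ancient x 0 k0"
      using P x1 unfolding P_def by blast
    then have unbounded: "\<exists>j>m. ancient x 0 j" "\<exists>j<m. ancient x 0 j" for m
      using P unfolding P_def by blast+
    have unique: "\<exists>!k. ancient x 0 k \<and> site x 0 k \<in> C" if C: "C \<in> orbit_components x" for C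
    proof -
      obtain n k where nk: "C = sigma_component (site x n k)" "one x n k"
        using C site_in_YL[OF XL] unfolding orbit_components_def orbit_eq by auto
      obtain j where "ancient x n j" "coalesce x n k j"
        using P nk(2) unfolding P_def by blast
      then obtain i where i: "ancient x 0 i" "site x 0 i \<in> C"
        using components_meet_ancient[OF XL nk(2)] nk(1) by blast
      show ?thesis
      proof (rule ex1I[of _ i])
        fix i' assume i': "ancient x 0 i' \<and> site x 0 i' \<in> C"
        then have "coalesce x 0 i' i"
          using same_component_coalesce[OF XL free nk(2)] i ancient_one unfolding nk(1) by blast
        then show "i' = i"
          using inj i' i by blast
      qed (use i in blast)
    qed
    have "infinite {k. ancient x 0 k}"
    proof
      assume fin: "finite {k. ancient x 0 k}"
      obtain j where "j > Max {k. ancient x 0 k}" "ancient x 0 j"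
        using unbounded by blast
      then show False
        using Max_ge[OF fin, of j] by simp
    qed
    moreover have "inj_on (\<lambda>k. sigma_component (site x 0 k)) {k. ancient x 0 k}"
    proof (rule inj_onI)
      fix i j assume "i \<in> {k. ancient x 0 k}" "j \<in> {k. ancient x 0 k}"
        and eq: "sigma_component (site x 0 i) = sigma_component (site x 0 j)"
      then have ij: "ancient x 0 i" "ancient x 0 j"
        by auto
      have "site x 0 i \<in> sigma_component (site x 0 i)" "site x 0 j \<in> sigma_component (site x 0 j)"
        using site_in_component[OF XL, of 0 _ 0 _ 0 0] ij ancient_one by auto
      then have "coalesce x 0 i j"
        using same_component_coalesce[OF XL free, of 0 i 0 i j] eq ij ancient_one by simp
      then show "i = j"
        using inj ij by blast
    qed
    moreover have "(\<lambda>k. sigma_component (site x 0 k)) ` {k. ancient x 0 k} \<subseteq> orbit_components x"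
      using ancient_one site_in_YL[OF XL] unfolding orbit_components_def orbit_eq by blast
    ultimately have "infinite (orbit_components x)"
      using finite_subset finite_imageD by blast
    moreover have "\<not> bdd_above {k. ancient x 0 k}" "\<not> bdd_below {k. ancient x 0 k}"
      using unbounded unfolding bdd_above_def bdd_below_def by (simp_all add: not_le conj_commute)
    ultimately show ?thesis
      unfolding shift_antidiagonal using unique Z by simp
  qed
  show ?thesis
    unfolding property_ii_def
  proof (intro conjI bexI[of _ B])
    show "\<forall>x\<in>YL \<inter> B. sigma_component x \<inter> ZL \<noteq> {}"
      using a by (rule ballI)
    show "\<forall>x\<in>ZL \<inter> B. \<exists>!y. y \<in> {y \<in> YL. sigmaL y = x} \<inter> ZL"
      using b by (rule ballI)
    show "\<forall>x\<in>YL \<inter> B. infinite (orbit_components x) \<and>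
        (\<forall>C\<in>orbit_components x. \<exists>!k. shiftZ2 k (- k) x \<in> ZL \<inter> C) \<and>
        \<not> bdd_above {k. shiftZ2 k (- k) x \<in> ZL} \<and> \<not> bdd_below {k. shiftZ2 k (- k) x \<in> ZL}"
      using c by (rule ballI)
  qed (use pos B in simp_all)
qed

end

theorem mainTheorem1:
  fixes \<mu> :: "config measure"
  assumes "prob_space \<mu>"
    and "sets \<mu> = sets borel_XL"
    and "atomless_measure \<mu>"
    and "invariant_measure \<mu>"
    and "ergodic_measure \<mu>"
  shows "(property_i \<mu> \<or> property_ii \<mu>) \<and> \<not> (property_i \<mu> \<and> property_ii \<mu>)"
proof -
  interpret ergodic_prob \<mu>
    using assms by (intro ergodic_prob.intro invariant_prob.intro invariant_prob_axioms.intro ergodic_prob_axioms.intro)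
  have "measure \<mu> ZL = 0" if "property_i \<mu>"
    using that unfolding property_i_def by (rule conjunct1)
  moreover have "measure \<mu> ZL > 0" if "property_ii \<mu>"
    using that unfolding property_ii_def by (rule conjunct1)
  ultimately show ?thesis
    using property_i_if_no_rightmost property_ii_if_rightmost by fastforce
qed

end
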